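(* Let $(X,x_0)$ be a connected pointed directed graph. Then there is a commutative diagram $$\begin{array}{ccccccc} \pi_1^{2}(X,x_0)&\to&\pi_1^{3}(X,x_0)&\to&\pi_1^{4}(X,x_0)&\to&\cdots\\ \downarrow{\scriptstyle h^2}&&\downarrow{\scriptstyle h^3}&&\downarrow{\scriptstyle h^4}&&\\ E^2_{1,0}(X)&\to&E^3_{1,0}(X)&\to&E^4_{1,0}(X)&\to&\cdots \end{array}$$ such that each $h^r$ ($2\le r<\infty$) is identified with abelianization (i.e. $h^r$ is a group homomorphism inducing an isomorphism from the abelianization of $\pi_1^r(X,x_0)$ onto $E^r_{1,0}(X)$), where the top sequence consists of the maps induced by the inclusions $\mathrm{N}^r(X)\subset\mathrm{N}^{r+1}(X)$ and the bottom sequence consists of the natural projections $E^r_{1,0}(X)\to E^{r+1}_{1,0}(X)$. Moreover, there is a natural map $$h^{\infty}\colon\pi_1^{\infty}(X,x_0)\to\mathrm{RH}_1(X)$$ which is identified with abelianization.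
   Context: A directed graph $X$ consists of a vertex set $V(X)$ and an edge set $E(X)\subset V(X)\times V(X)-\Delta$, where $\Delta$ is the diagonal; $(x,y)\in E(X)$ is an edge from $x$ to $y$. A map $f\colon X\to Y$ of directed graphs is a function $V(X)\to V(Y)$ such that for every $(x,y)\in E(X)$ either $(f(x),f(y))\in E(Y)$ or $f(x)=f(y)$. A pointed directed graph $(X,x_0)$ is a directed graph with a chosen vertex $x_0$. $X$ is connected if any two vertices are connected by a zig-zag of finitely many edges (edges traversed in either direction). For vertices $x,y$, $d(x,y)$ is the minimal $n$ such that there are vertices $x=x_0,\ldots,x_n=y$ with $(x_i,x_{i+1})\in E(X)$ for all $i$, and $d(x,y)=\infty$ if there is none. Put $L(x_0,\ldots,x_n)=\sum_{i=0}^{n-1}d(x_i,x_{i+1})$. For $0\le r<\infty$, $\mathrm{N}^r(X)$ is the simplicial set whose $n$-simplices are the tuples $(x_0,\ldots,x_n)\in V(X)^{n+1}$ with $L(x_0,\ldots,x_n)\le r$, faces delete an entry and degeneracies repeat an entry; $\mathrm{N}^\infty(X)=\mathrm{N}(X)$ is defined likewise with $L(x_0,\ldots,x_n)<\infty$. For $1\le r\le\infty$, the $r$-fundamental groupoid $\Pi_1^r(X)$ is the edge-path groupoid of $\mathrm{N}^r(X)$: its objects are the vertices of $X$, and it is the groupoid generated by the $1$-simplices $(x,y)$ of $\mathrm{N}^r(X)$ (as morphisms $x\to y$), subject to $(x,x)=1_x$ and, for each $2$-simplex $(x,y,z)$, that $(x,z)$ equals $(x,y)$ followed by $(y,z)$.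 The $r$-fundamental group is $\pi_1^r(X,x_0)=\Pi_1^r(X)(x_0,x_0)$. $\mathrm{RC}_*(X)$ is the normalized Moore complex of $\mathrm{N}(X)$: $\mathrm{RC}_n(X)$ is the free abelian group on tuples $(x_0,\ldots,x_n)$ with $L(x_0,\ldots,x_n)<\infty$ and $x_i\ne x_{i+1}$ for all $i$, with $\partial(x_0,\ldots,x_n)=\sum_{i=0}^n(-1)^i(x_0,\ldots,\widehat{x_i},\ldots,x_n)$, where tuples with two equal consecutive entries are set to $0$. The reachability homology is $\mathrm{RH}_*(X)=H_*(\mathrm{RC}_*(X))$. $F_p\mathrm{RC}_*(X)\subset\mathrm{RC}_*(X)$ is the subcomplex spanned by generators with $L\le p$. The magnitude-path spectral sequence (MPSS) $E^r_{p,q}(X)$ is the homology spectral sequence of this filtration (standard indexing, $p$ the filtration degree and $p+q$ the total degree, $d^r$ of bidegree $(-r,r-1)$): $E^r_{p,q}=Z^r_{p,q}/(Z^{r-1}_{p-1,q+1}+\partial Z^{r-1}_{p+r-1,q-r+2})$ with $Z^r_{p,q}=\{c\in F_p\mathrm{RC}_{p+q}(X)\mid\partial c\in F_{p-r}\mathrm{RC}_{p+q-1}(X)\}$. It is a fourth quadrant spectral sequence, so for $2\le r<\infty$ the differential $d^r$ vanishes on $E^r_{1,0}(X)$ and there is a natural projection $E^r_{1,0}(X)\to E^{r+1}_{1,0}(X)$. *)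

theory Defs
  imports
    "Graph_Theory.Digraph_Component"
    "HOL-Library.Extended_Nat"
    "HOL-Algebra.Free_Abelian_Groups"
    "HOL-Algebra.Generated_Groups"
begin

section \<open>Directed graphs\<close>

text \<open>
  A directed graph is a \<^typ>\<open>'a pair_pre_digraph\<close> satisfying \<^locale>\<open>pair_loopfree_digraph\<close>, that is,
  its arcs are pairs of distinct vertices; neither vertices nor arcs are required to be finite.
  \<^const>\<open>Digraph_Component.connected\<close> is reachability in the symmetrized graph, i.e. by zig-zags.
\<close>

definition conn_pointed_digraph :: "'a pair_pre_digraph \<Rightarrow> 'a \<Rightarrow> bool" where
  "conn_pointed_digraph X x0 \<longleftrightarrow>
     pair_loopfree_digraph X \<and> x0 \<in> pverts X \<and> Digraph_Component.connected (with_proj X)"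

definition pointed_digraph_map ::
    "'a pair_pre_digraph \<Rightarrow> 'a \<Rightarrow> 'b pair_pre_digraph \<Rightarrow> 'b \<Rightarrow> ('a \<Rightarrow> 'b) \<Rightarrow> bool" where
  "pointed_digraph_map X x0 Y y0 f \<longleftrightarrow>
     f ` pverts X \<subseteq> pverts Y \<and>
     (\<forall>(x, y) \<in> parcs X. (f x, f y) \<in> parcs Y \<or> f x = f y) \<and>
     f x0 = y0"

text \<open>
  \<open>(x, y) \<in> parcs X ^^ n\<close> says that there is a directed path with \<open>n\<close> edges
  from \<open>x\<close> to \<open>y\<close>; the infimum of the empty set is \<open>\<infinity>\<close>.
\<close>

definition ddist :: "'a pair_pre_digraph \<Rightarrow> 'a \<Rightarrow> 'a \<Rightarrow> enat" where
  "ddist X x y = (INF n \<in> {n. (x, y) \<in> parcs X ^^ n}. enat n)"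

definition tuple_length :: "'a pair_pre_digraph \<Rightarrow> 'a list \<Rightarrow> enat" where
  "tuple_length X xs = (\<Sum>i < length xs - 1. ddist X (xs ! i) (xs ! Suc i))"

text \<open>
  The \<open>n\<close>-simplices of \<open>N\<^sup>r(X)\<close>, as lists of length \<open>n + 1\<close>. The conjunct \<open>< \<infinity>\<close> is
  automatic for finite \<open>r\<close> and gives \<open>N(X)\<close> for \<open>r = \<infinity>\<close>. Faces delete an entry and
  degeneracies repeat one.
\<close>

definition nerve :: "enat \<Rightarrow> 'a pair_pre_digraph \<Rightarrow> nat \<Rightarrow> 'a list set" where
  "nerve r X n = {xs. length xs = n + 1 \<and> set xs \<subseteq> pverts X \<and>
                      tuple_length X xs \<le> r \<and> tuple_length X xs < \<infinity>}"


section \<open>The edge-path groupoid\<close>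

text \<open>
  In this section \<open>K n\<close> is the set of \<open>n\<close>-simplices of a simplicial set whose simplices are tuples
  of vertices. \<open>Fwd x y\<close> stands for the generator \<open>(x, y) : x \<rightarrow> y\<close> of the edge-path
  groupoid and \<open>Bwd x y\<close> for its formal inverse \<open>y \<rightarrow> x\<close>.
\<close>

datatype 'a edge_step = Fwd 'a 'a | Bwd 'a 'a

inductive edge_path :: "(nat \<Rightarrow> 'a list set) \<Rightarrow> 'a \<Rightarrow> 'a edge_step list \<Rightarrow> 'a \<Rightarrow> bool"
  for K where
  Nil: "[x] \<in> K 0 \<Longrightarrow> edge_path K x [] x"
| Fwd: "[x, y] \<in> K 1 \<Longrightarrow> edge_path K y w z \<Longrightarrow> edge_path K x (Fwd x y # w) z"
| Bwd: "[x, y] \<in> K 1 \<Longrightarrow> edge_path K x w z \<Longrightarrow> edge_path K y (Bwd x y # w) z"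

text \<open>
  \<open>edge_path_eq K x y\<close> is the congruence on edge paths from \<open>x\<close> to \<open>y\<close> generated by
  the groupoid laws and the relations \<open>(x, x) = 1\<^sub>x\<close> and \<open>(x, y)(y, z) = (x, z)\<close>. Words are
  read from left to right: \<open>v @ w\<close> is \<open>v\<close> followed by \<open>w\<close>.
\<close>

inductive edge_path_eq ::
    "(nat \<Rightarrow> 'a list set) \<Rightarrow> 'a \<Rightarrow> 'a \<Rightarrow> 'a edge_step list \<Rightarrow> 'a edge_step list \<Rightarrow> bool"
  for K where
  refl: "edge_path K x w y \<Longrightarrow> edge_path_eq K x y w w"
| sym: "edge_path_eq K x y v w \<Longrightarrow> edge_path_eq K x y w v"
| trans: "edge_path_eq K x y u v \<Longrightarrow> edge_path_eq K x y v w \<Longrightarrow> edge_path_eq K x y u w"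
| cong: "edge_path_eq K x y v v' \<Longrightarrow> edge_path_eq K y z w w' \<Longrightarrow>
           edge_path_eq K x z (v @ w) (v' @ w')"
| inv_right: "[x, y] \<in> K 1 \<Longrightarrow> edge_path_eq K x x [Fwd x y, Bwd x y] []"
| inv_left: "[x, y] \<in> K 1 \<Longrightarrow> edge_path_eq K y y [Bwd x y, Fwd x y] []"
| degenerate: "[x] \<in> K 0 \<Longrightarrow> edge_path_eq K x x [Fwd x x] []"
| triangle: "[x, y, z] \<in> K 2 \<Longrightarrow> edge_path_eq K x z [Fwd x y, Fwd y z] [Fwd x z]"

definition edge_path_class ::
    "(nat \<Rightarrow> 'a list set) \<Rightarrow> 'a \<Rightarrow> 'a \<Rightarrow> 'a edge_step list \<Rightarrow> 'a edge_step list set" where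
  "edge_path_class K x y w = {v. edge_path_eq K x y w v}"

definition groupoid_hom :: "(nat \<Rightarrow> 'a list set) \<Rightarrow> 'a \<Rightarrow> 'a \<Rightarrow> 'a edge_step list set set" where
  "groupoid_hom K x y = {edge_path_class K x y w | w. edge_path K x w y}"

definition groupoid_comp :: "(nat \<Rightarrow> 'a list set) \<Rightarrow> 'a \<Rightarrow> 'a \<Rightarrow>
    'a edge_step list set \<Rightarrow> 'a edge_step list set \<Rightarrow> 'a edge_step list set" where
  "groupoid_comp K x z A B = (\<Union>v \<in> A. \<Union>w \<in> B. edge_path_class K x z (v @ w))"

definition vertex_group :: "(nat \<Rightarrow> 'a list set) \<Rightarrow> 'a \<Rightarrow> 'a edge_step list set monoid" where
  "vertex_group K x =
     \<lparr>carrier = groupoid_hom K x x, monoid.mult = groupoid_comp K x x, one = edge_path_class K x x []\<rparr>"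

text \<open>
  The map on vertex groups, into that of \<open>K'\<close> at \<open>y\<close>, induced by the simplicial map that applies
  \<open>f\<close> entrywise.
\<close>

definition vertex_group_map :: "(nat \<Rightarrow> 'b list set) \<Rightarrow> 'b \<Rightarrow> ('a \<Rightarrow> 'b) \<Rightarrow>
    'a edge_step list set \<Rightarrow> 'b edge_step list set" where
  "vertex_group_map K' y f A = (\<Union>w \<in> A. edge_path_class K' y y (map (map_edge_step f) w))"

definition fund_group :: "enat \<Rightarrow> 'a pair_pre_digraph \<Rightarrow> 'a \<Rightarrow> 'a edge_step list set monoid" where
  "fund_group r X x0 = vertex_group (nerve r X) x0"

definition fund_group_incl ::
    "enat \<Rightarrow> 'a pair_pre_digraph \<Rightarrow> 'a \<Rightarrow> 'a edge_step list set \<Rightarrow> 'a edge_step list set" where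
  "fund_group_incl r' X x0 = vertex_group_map (nerve r' X) x0 id"

definition fund_group_map :: "enat \<Rightarrow> 'b pair_pre_digraph \<Rightarrow> 'b \<Rightarrow> ('a \<Rightarrow> 'b) \<Rightarrow>
    'a edge_step list set \<Rightarrow> 'b edge_step list set" where
  "fund_group_map r Y y0 f = vertex_group_map (nerve r Y) y0 f"


section \<open>Reachability homology\<close>

text \<open>Degrees are integers, with zero chain groups in negative degrees.\<close>

definition RC_gens :: "'a pair_pre_digraph \<Rightarrow> int \<Rightarrow> 'a list set" where
  "RC_gens X n = {xs. 0 \<le> n \<and> xs \<in> nerve \<infinity> X (nat n) \<and> distinct_adj xs}"

definition RC :: "'a pair_pre_digraph \<Rightarrow> int \<Rightarrow> ('a list \<Rightarrow>\<^sub>0 int) monoid" where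
  "RC X n = free_Abelian_group (RC_gens X n)"

text \<open>
  The normalized chain of a tuple. The empty tuple, which arises as the face of a
  \<open>0\<close>-simplex, is sent to \<open>0\<close>.
\<close>

definition norm_tuple :: "'a list \<Rightarrow> ('a list \<Rightarrow>\<^sub>0 int)" where
  "norm_tuple xs = (if xs \<noteq> [] \<and> distinct_adj xs then frag_of xs else 0)"

definition RC_boundary :: "('a list \<Rightarrow>\<^sub>0 int) \<Rightarrow> ('a list \<Rightarrow>\<^sub>0 int)" where
  "RC_boundary = frag_extend (\<lambda>xs. \<Sum>i < length xs.
     frag_cmul ((-1) ^ i) (norm_tuple (take i xs @ drop (Suc i) xs)))"

definition RC_map :: "('a \<Rightarrow> 'b) \<Rightarrow> ('a list \<Rightarrow>\<^sub>0 int) \<Rightarrow> ('b list \<Rightarrow>\<^sub>0 int)" where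
  "RC_map f = frag_extend (\<lambda>xs. norm_tuple (map f xs))"

definition RC_cycles :: "'a pair_pre_digraph \<Rightarrow> int \<Rightarrow> ('a list \<Rightarrow>\<^sub>0 int) set" where
  "RC_cycles X n = {c \<in> carrier (RC X n). RC_boundary c = 0}"

definition RC_boundaries :: "'a pair_pre_digraph \<Rightarrow> int \<Rightarrow> ('a list \<Rightarrow>\<^sub>0 int) set" where
  "RC_boundaries X n = RC_boundary ` carrier (RC X (n + 1))"

definition RH :: "'a pair_pre_digraph \<Rightarrow> int \<Rightarrow> ('a list \<Rightarrow>\<^sub>0 int) set monoid" where
  "RH X n = (RC X n)\<lparr>carrier := RC_cycles X n\<rparr> Mod RC_boundaries X n"

text \<open>The map on homology classes with values in \<open>RH Y n\<close> induced by \<open>RC_map f\<close>.\<close>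

definition RH_map :: "'b pair_pre_digraph \<Rightarrow> int \<Rightarrow> ('a \<Rightarrow> 'b) \<Rightarrow>
    ('a list \<Rightarrow>\<^sub>0 int) set \<Rightarrow> ('b list \<Rightarrow>\<^sub>0 int) set" where
  "RH_map Y n f C = (\<Union>c \<in> C. RC_boundaries Y n #>\<^bsub>RC Y n\<^esub> RC_map f c)"


section \<open>The magnitude-path spectral sequence\<close>

definition RC_filt :: "'a pair_pre_digraph \<Rightarrow> int \<Rightarrow> int \<Rightarrow> ('a list \<Rightarrow>\<^sub>0 int) set" where
  "RC_filt X p n = carrier (free_Abelian_group
     {xs \<in> RC_gens X n. \<exists>k. tuple_length X xs = enat k \<and> int k \<le> p})"

definition MPSS_Z :: "'a pair_pre_digraph \<Rightarrow> int \<Rightarrow> int \<Rightarrow> int \<Rightarrow> ('a list \<Rightarrow>\<^sub>0 int) set" where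
  "MPSS_Z X r p q = {c \<in> RC_filt X p (p + q). RC_boundary c \<in> RC_filt X (p - r) (p + q - 1)}"

definition MPSS_B :: "'a pair_pre_digraph \<Rightarrow> int \<Rightarrow> int \<Rightarrow> int \<Rightarrow> ('a list \<Rightarrow>\<^sub>0 int) set" where
  "MPSS_B X r p q = {a + RC_boundary b | a b.
     a \<in> MPSS_Z X (r - 1) (p - 1) (q + 1) \<and> b \<in> MPSS_Z X (r - 1) (p + r - 1) (q - r + 2)}"

definition MPSS :: "'a pair_pre_digraph \<Rightarrow> int \<Rightarrow> int \<Rightarrow> int \<Rightarrow> ('a list \<Rightarrow>\<^sub>0 int) set monoid" where
  "MPSS X r p q = (RC X (p + q))\<lparr>carrier := MPSS_Z X r p q\<rparr> Mod MPSS_B X r p q"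

text \<open>
  The projection \<open>ker d\<^sup>r \<rightarrow> E\<^sup>r\<^sup>+\<^sup>1\<^sub>p\<^sub>,\<^sub>q\<close> from the kernel of \<open>d\<^sup>r\<close> in \<open>E\<^sup>r\<^sub>p\<^sub>,\<^sub>q\<close>. The elements of
  this kernel are exactly the cosets that meet \<open>Z\<^sup>r\<^sup>+\<^sup>1\<^sub>p\<^sub>,\<^sub>q\<close>; such a coset is sent to the class
  of any representative lying there.
\<close>

definition MPSS_proj :: "'a pair_pre_digraph \<Rightarrow> int \<Rightarrow> int \<Rightarrow> int \<Rightarrow>
    ('a list \<Rightarrow>\<^sub>0 int) set \<Rightarrow> ('a list \<Rightarrow>\<^sub>0 int) set" where
  "MPSS_proj X r p q C =
     (\<Union>c \<in> C \<inter> MPSS_Z X (r + 1) p q. MPSS_B X (r + 1) p q #>\<^bsub>RC X (p + q)\<^esub> c)"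


section \<open>Abelianization\<close>

definition is_abelianization ::
    "('a, 'm) monoid_scheme \<Rightarrow> ('b, 'n) monoid_scheme \<Rightarrow> ('a \<Rightarrow> 'b) \<Rightarrow> bool" where
  "is_abelianization G H h \<longleftrightarrow> group_hom G H h \<and>
     (\<exists>\<phi> \<in> iso (G Mod derived G (carrier G)) H.
        \<forall>g \<in> carrier G. \<phi> (derived G (carrier G) #>\<^bsub>G\<^esub> g) = h g)"

end

theory Submission
  imports Defs
begin

text \<open>
  The statement is the Hurewicz theorem in degree one, applied to the nerves \<open>N\<^sup>r(X)\<close>, once the
  groups \<open>E\<^sup>r\<^sub>1\<^sub>,\<^sub>0\<close> have been recognized as first homology groups.

  For \<open>2 \<le> r < \<infinity>\<close> an element of \<open>Z\<^sup>r\<^sub>1\<^sub>,\<^sub>0\<close> is a 1-chain of filtration degree \<open>1\<close> whose boundary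
  has negative filtration degree, that is, a cycle supported on arcs of \<open>X\<close>. Since \<open>F\<^sub>0 RC\<^sub>1 = 0\<close>,
  what is divided out are exactly the boundaries of 2-chains of \<open>N\<^sup>r(X)\<close> that are supported on arcs.
  So \<open>E\<^sup>r\<^sub>1\<^sub>,\<^sub>0 = Z / (Z \<inter> B)\<close>, where \<open>Z\<close> is the group of cycles on arcs and \<open>B\<close> the group of
  1-boundaries of \<open>N\<^sup>r(X)\<close> (\<open>MPSS_eq\<close>). An edge \<open>(x, y)\<close> of \<open>N\<^sup>r(X)\<close> is homologous in \<open>N\<^sup>r(X)\<close> to
  the sum of the arcs of a shortest path from \<open>x\<close> to \<open>y\<close>, as this path can be cut off by 2-simplices
  of length at most \<open>r\<close>. Hence \<open>Z\<close> meets every homology class of cycles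
  (\<open>cycle_homologous_to_arc_cycle\<close>), and \<open>Z / (Z \<inter> B)\<close> is \<open>H\<^sub>1(N\<^sup>r(X))\<close>.

  The Hurewicz map sends the class of a loop \<open>w\<close> to the set of all \<open>c \<in> Z\<close> for which \<open>c\<close> minus the
  chain of \<open>w\<close> is a boundary. This set is a coset of \<open>Z \<inter> B\<close>. Its description involves no choice of
  paths or of representatives, and \<open>Z\<close> is the same for all finite \<open>r\<close>; therefore compatibility with
  the projections and naturality follow by comparing boundaries (\<open>hurewicz_map_projection\<close>,
  \<open>hurewicz_map_natural\<close>). For \<open>r = \<infinity>\<close> the same map with \<open>Z\<close> the group of all cycles has values in
  \<open>RH\<^sub>1(X)\<close>.

  That the map is the abelianization (\<open>hurewicz\<close>) is the classical argument. A path from the base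
  point to every vertex is chosen, and each edge is closed up to a loop by these paths. On the one hand
  this writes any cycle as the chain of a loop (\<open>cycle_is_chain_of_loop\<close>). On the other hand it
  defines a homomorphism from 1-chains to the abelianized group which kills boundaries and
  recovers the class of a loop from its chain, so that a loop with null-homologous chain lies in the
  derived subgroup (\<open>null_homologous_imp_derived\<close>).
\<close>

text \<open>
  The rules of the edge-path groupoid speak of \<open>K 1\<close>, which simplification would otherwise turn
  into \<open>K (Suc 0)\<close>.
\<close>

declare One_nat_def [simp del]

section \<open>Edge-path groupoids\<close>

text \<open>
  The part of the structure of a simplicial set of tuples, in dimensions at most two, on which
  the edge-path groupoid and the first homology group depend.
\<close>

locale edge_path_complex =
  fixes K :: "nat \<Rightarrow> 'a list set"
  assumes simplex_length: "xs \<in> K n \<Longrightarrow> length xs = n + 1"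
    and vertices: "[x, y] \<in> K 1 \<Longrightarrow> [x] \<in> K 0 \<and> [y] \<in> K 0"
    and degenerate_edge: "[x] \<in> K 0 \<Longrightarrow> [x, x] \<in> K 1"
    and edges: "[x, y, z] \<in> K 2 \<Longrightarrow> [x, y] \<in> K 1 \<and> [y, z] \<in> K 1 \<and> [x, z] \<in> K 1"

fun flip_step :: "'a edge_step \<Rightarrow> 'a edge_step" where
  "flip_step (Fwd x y) = Bwd x y"
| "flip_step (Bwd x y) = Fwd x y"

definition inv_path :: "'a edge_step list \<Rightarrow> 'a edge_step list" where
  "inv_path w = rev (map flip_step w)"

lemma inv_path_simps [simp]:
  "inv_path [] = []"
  "inv_path (s # w) = inv_path w @ [flip_step s]"
  "inv_path (v @ w) = inv_path w @ inv_path v"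
  by (simp_all add: inv_path_def)

lemma flip_step_flip_step [simp]: "flip_step (flip_step s) = s"
  by (cases s) auto

lemma inv_path_inv_path [simp]: "inv_path (inv_path w) = w"
  by (induction w) auto

lemma edge_path_append:
  "edge_path K x v y \<Longrightarrow> edge_path K y w z \<Longrightarrow> edge_path K x (v @ w) z"
  by (induction rule: edge_path.induct) (auto intro: edge_path.intros)

context edge_path_complex
begin

lemma edge_path_vertices:
  "edge_path K x w y \<Longrightarrow> [x] \<in> K 0 \<and> [y] \<in> K 0"
  by (induction rule: edge_path.induct) (auto dest: vertices)

lemma edge_path_Fwd: "[x, y] \<in> K 1 \<Longrightarrow> edge_path K x [Fwd x y] y"
  by (auto dest: vertices intro!: edge_path.intros)

lemma edge_path_Bwd: "[x, y] \<in> K 1 \<Longrightarrow> edge_path K y [Bwd x y] x"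
  by (auto dest: vertices intro!: edge_path.intros)

lemma edge_path_inv: "edge_path K x w y \<Longrightarrow> edge_path K y (inv_path w) x"
  by (induction rule: edge_path.induct)
    (auto intro: edge_path.intros edge_path_append edge_path_Fwd edge_path_Bwd)

lemma edge_path_eq_imp_edge_path:
  "edge_path_eq K x y v w \<Longrightarrow> edge_path K x v y \<and> edge_path K x w y"
proof (induction rule: edge_path_eq.induct)
  case (inv_right x y)
  then show ?case
    using edge_path_append [OF edge_path_Fwd edge_path_Bwd] vertices by (auto intro: edge_path.Nil)
next
  case (inv_left x y)
  then show ?case
    using edge_path_append [OF edge_path_Bwd edge_path_Fwd] vertices by (auto intro: edge_path.Nil)
next
  case (degenerate x)
  then show ?case
    by (auto intro: edge_path.Nil edge_path_Fwd degenerate_edge)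
next
  case (triangle x y z)
  then have "[x, y] \<in> K 1" "[y, z] \<in> K 1" "[x, z] \<in> K 1"
    using edges by blast+
  then show ?case
    using edge_path_append [OF edge_path_Fwd edge_path_Fwd] by (auto intro: edge_path_Fwd)
qed (auto intro: edge_path_append)

lemma edge_path_eq_context:
  assumes "edge_path K x u y" "edge_path_eq K y y' v v'" "edge_path K y' w z"
  shows "edge_path_eq K x z (u @ v @ w) (u @ v' @ w)"
  using assms by (meson edge_path_eq.cong edge_path_eq.refl)

text \<open>
  Cancellation happens from the inside out, by induction on the path: the innermost pair of a step
  and its inverse disappears first.
\<close>

lemma edge_path_inv_right: "edge_path K x w y \<Longrightarrow> edge_path_eq K x x (w @ inv_path w) []"
proof (induction rule: edge_path.induct)
  case (Nil x)
  then show ?case by (auto intro: edge_path_eq.refl edge_path.Nil)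
next
  case (Fwd x y w z)
  have "edge_path_eq K x x ([Fwd x y] @ (w @ inv_path w) @ [Bwd x y]) ([Fwd x y] @ [] @ [Bwd x y])"
    by (rule edge_path_eq_context
          [OF edge_path_Fwd [OF Fwd.hyps(1)] Fwd.IH edge_path_Bwd [OF Fwd.hyps(1)]])
  then show ?case
    using edge_path_eq.trans [OF _ edge_path_eq.inv_right [of x y K]] Fwd.hyps(1) by simp
next
  case (Bwd x y w z)
  have "edge_path_eq K y y ([Bwd x y] @ (w @ inv_path w) @ [Fwd x y]) ([Bwd x y] @ [] @ [Fwd x y])"
    by (rule edge_path_eq_context
          [OF edge_path_Bwd [OF Bwd.hyps(1)] Bwd.IH edge_path_Fwd [OF Bwd.hyps(1)]])
  then show ?case
    using edge_path_eq.trans [OF _ edge_path_eq.inv_left [of x y K]] Bwd.hyps(1) by simp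
qed

lemma edge_path_inv_left: "edge_path K x w y \<Longrightarrow> edge_path_eq K y y (inv_path w @ w) []"
  using edge_path_inv_right [OF edge_path_inv] by fastforce

lemma edge_path_class_eq_iff:
  assumes "edge_path K x v y"
  shows "edge_path_class K x y v = edge_path_class K x y w \<longleftrightarrow> edge_path_eq K x y v w"
proof
  assume "edge_path_class K x y v = edge_path_class K x y w"
  moreover have "v \<in> edge_path_class K x y v"
    using assms by (simp add: edge_path_class_def edge_path_eq.refl)
  ultimately show "edge_path_eq K x y v w"
    by (simp add: edge_path_class_def edge_path_eq.sym)
next
  assume "edge_path_eq K x y v w"
  then show "edge_path_class K x y v = edge_path_class K x y w"
    unfolding edge_path_class_def by (blast intro: edge_path_eq.sym edge_path_eq.trans)
qed

lemma groupoid_comp_class: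
  assumes "edge_path K x v y" "edge_path K y w z"
  shows "groupoid_comp K x z (edge_path_class K x y v) (edge_path_class K y z w)
       = edge_path_class K x z (v @ w)"
proof -
  have "edge_path_class K x z (v' @ w') = edge_path_class K x z (v @ w)"
    if "v' \<in> edge_path_class K x y v" "w' \<in> edge_path_class K y z w" for v' w'
  proof -
    have eq: "edge_path_eq K x z (v @ w) (v' @ w')"
      using that by (auto simp: edge_path_class_def intro: edge_path_eq.cong)
    show ?thesis
      using edge_path_class_eq_iff [OF edge_path_append [OF assms]] eq by blast
  qed
  moreover have "v \<in> edge_path_class K x y v" "w \<in> edge_path_class K y z w"
    using assms by (auto simp: edge_path_class_def edge_path_eq.refl)
  ultimately show ?thesis
    unfolding groupoid_comp_def by blast
qed

abbreviation (input) loop_class :: "'a \<Rightarrow> 'a edge_step list \<Rightarrow> 'a edge_step list set" where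
  "loop_class x w \<equiv> edge_path_class K x x w"

lemma vertex_group_simps:
  "carrier (vertex_group K x) = {loop_class x w | w. edge_path K x w x}"
  "\<one>\<^bsub>vertex_group K x\<^esub> = loop_class x []"
  "edge_path K x v x \<Longrightarrow> edge_path K x w x \<Longrightarrow>
     loop_class x v \<otimes>\<^bsub>vertex_group K x\<^esub> loop_class x w = loop_class x (v @ w)"
  by (auto simp: vertex_group_def groupoid_hom_def groupoid_comp_class)

lemma group_vertex_group:
  assumes "[x] \<in> K 0"
  shows "group (vertex_group K x)"
proof (rule groupI)
  show "\<one>\<^bsub>vertex_group K x\<^esub> \<in> carrier (vertex_group K x)"
    using assms by (auto simp: vertex_group_simps intro: edge_path.Nil)
next
  fix A assume "A \<in> carrier (vertex_group K x)"
  then obtain w where w: "A = loop_class x w" "edge_path K x w x"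
    by (auto simp: vertex_group_simps)
  have "edge_path K x (inv_path w @ w) x"
    by (rule edge_path_append [OF edge_path_inv [OF w(2)] w(2)])
  then have "loop_class x (inv_path w) \<otimes>\<^bsub>vertex_group K x\<^esub> A = \<one>\<^bsub>vertex_group K x\<^esub>"
    using w edge_path_inv_left [OF w(2)]
    by (simp add: vertex_group_simps edge_path_inv edge_path_class_eq_iff)
  then show "\<exists>B\<in>carrier (vertex_group K x). B \<otimes>\<^bsub>vertex_group K x\<^esub> A = \<one>\<^bsub>vertex_group K x\<^esub>"
    using edge_path_inv [OF w(2)] by (auto simp: vertex_group_simps(1))
next
  fix A B assume "A \<in> carrier (vertex_group K x)" "B \<in> carrier (vertex_group K x)"
  then show "A \<otimes>\<^bsub>vertex_group K x\<^esub> B \<in> carrier (vertex_group K x)"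
    using edge_path_append by (fastforce simp: vertex_group_simps)
next
  fix A B C
  assume "A \<in> carrier (vertex_group K x)" "B \<in> carrier (vertex_group K x)"
    "C \<in> carrier (vertex_group K x)"
  then obtain u v w where
    "A = loop_class x u" "edge_path K x u x" "B = loop_class x v" "edge_path K x v x"
    "C = loop_class x w" "edge_path K x w x"
    by (auto simp: vertex_group_simps)
  then show "A \<otimes>\<^bsub>vertex_group K x\<^esub> B \<otimes>\<^bsub>vertex_group K x\<^esub> C
      = A \<otimes>\<^bsub>vertex_group K x\<^esub> (B \<otimes>\<^bsub>vertex_group K x\<^esub> C)"
    by (simp add: vertex_group_simps edge_path_append [of K x _ x])
qed (use assms in \<open>auto simp: vertex_group_simps edge_path.Nil\<close>)

end

text \<open>
  The edge-path groupoid is functorial: the next lemmas apply both to the inclusion of one nerve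
  into a larger one, where \<open>f\<close> is the identity, and to the map of nerves that a map of digraphs
  induces.
\<close>

lemma edge_path_map:
  assumes "\<And>n xs. xs \<in> K n \<Longrightarrow> map f xs \<in> K' n"
  shows "edge_path K x w y \<Longrightarrow> edge_path K' (f x) (map (map_edge_step f) w) (f y)"
proof (induction rule: edge_path.induct)
  case (Nil x) then show ?case using assms [of "[x]" 0] by (auto intro: edge_path.Nil)
next
  case (Fwd x y w z) then show ?case using assms [of "[x, y]" 1] by (auto intro: edge_path.Fwd)
next
  case (Bwd x y w z) then show ?case using assms [of "[x, y]" 1] by (auto intro: edge_path.Bwd)
qed

lemma edge_path_eq_map:
  assumes "\<And>n xs. xs \<in> K n \<Longrightarrow> map f xs \<in> K' n"
  shows "edge_path_eq K x y v w \<Longrightarrow>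
    edge_path_eq K' (f x) (f y) (map (map_edge_step f) v) (map (map_edge_step f) w)"
proof (induction rule: edge_path_eq.induct)
  case (refl x w y) then show ?case by (auto intro: edge_path_eq.refl edge_path_map [OF assms])
next
  case (sym x y v w) then show ?case by (auto intro: edge_path_eq.sym)
next
  case (trans x y u v w) then show ?case by (auto intro: edge_path_eq.trans)
next
  case (cong x y v v' z w w') then show ?case by (auto intro: edge_path_eq.cong)
next
  case (inv_right x y)
  then show ?case using assms [of "[x, y]" 1] by (auto intro: edge_path_eq.inv_right)
next
  case (inv_left x y)
  then show ?case using assms [of "[x, y]" 1] by (auto intro: edge_path_eq.inv_left)
next
  case (degenerate x)
  then show ?case using assms [of "[x]" 0] by (auto intro: edge_path_eq.degenerate)
next
  case (triangle x y z)
  then show ?case using assms [of "[x, y, z]" 2] by (auto intro: edge_path_eq.triangle)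
qed

lemma (in edge_path_complex) vertex_group_map_class:
  assumes K': "edge_path_complex K'" "\<And>n xs. xs \<in> K n \<Longrightarrow> map f xs \<in> K' n"
    and w: "edge_path K x w x"
  shows "vertex_group_map K' (f x) f (loop_class x w)
       = edge_path_class K' (f x) (f x) (map (map_edge_step f) w)"
proof -
  interpret K': edge_path_complex K' by fact
  have "edge_path_class K' (f x) (f x) (map (map_edge_step f) v)
      = edge_path_class K' (f x) (f x) (map (map_edge_step f) w)" if "v \<in> loop_class x w" for v
  proof -
    have "edge_path_eq K' (f x) (f x) (map (map_edge_step f) v) (map (map_edge_step f) w)"
      using that by (intro edge_path_eq_map [OF K'(2)]) (auto simp: edge_path_class_def edge_path_eq.sym)
    then show ?thesis
      using K'.edge_path_class_eq_iff K'.edge_path_eq_imp_edge_path by blast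
  qed
  moreover have "w \<in> loop_class x w"
    using w by (simp add: edge_path_class_def edge_path_eq.refl)
  ultimately show ?thesis
    unfolding vertex_group_map_def by blast
qed

section \<open>Chains in dimensions one and two\<close>

definition normalized_chains :: "(nat \<Rightarrow> 'a list set) \<Rightarrow> nat \<Rightarrow> ('a list \<Rightarrow>\<^sub>0 int) set" where
  "normalized_chains K n = carrier (free_Abelian_group {xs \<in> K n. distinct_adj xs})"

definition cycles :: "(nat \<Rightarrow> 'a list set) \<Rightarrow> ('a list \<Rightarrow>\<^sub>0 int) set" where
  "cycles K = {c \<in> normalized_chains K 1. RC_boundary c = 0}"

definition boundaries :: "(nat \<Rightarrow> 'a list set) \<Rightarrow> ('a list \<Rightarrow>\<^sub>0 int) set" where
  "boundaries K = RC_boundary ` normalized_chains K 2"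

text \<open>
  The chain of a path is the signed sum of the edges that it traverses. A constant edge has chain
  \<open>0\<close>, in accordance with both the normalization of chains and the relation \<open>(x, x) = 1\<^sub>x\<close>.
\<close>

fun step_chain :: "'a edge_step \<Rightarrow> ('a list \<Rightarrow>\<^sub>0 int)" where
  "step_chain (Fwd x y) = norm_tuple [x, y]"
| "step_chain (Bwd x y) = - norm_tuple [x, y]"

definition path_chain :: "'a edge_step list \<Rightarrow> ('a list \<Rightarrow>\<^sub>0 int)" where
  "path_chain w = (\<Sum>s\<leftarrow>w. step_chain s)"

lemma path_chain_simps [simp]:
  "path_chain [] = 0"
  "path_chain (s # w) = step_chain s + path_chain w"
  "path_chain (v @ w) = path_chain v + path_chain w"
  by (simp_all add: path_chain_def)

lemma step_chain_flip [simp]: "step_chain (flip_step s) = - step_chain s"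
  by (cases s) auto

lemma path_chain_inv [simp]: "path_chain (inv_path w) = - path_chain w"
  by (induction w) auto

lemma RC_boundary_linear [simp]:
  "RC_boundary 0 = 0"
  "RC_boundary (a + b) = RC_boundary a + RC_boundary b"
  "RC_boundary (a - b) = RC_boundary a - RC_boundary b"
  "RC_boundary (- a) = - RC_boundary a"
  by (simp_all add: RC_boundary_def frag_extend_add frag_extend_diff frag_extend_minus)

lemma norm_tuple_simps [simp]:
  "norm_tuple [] = 0"
  "norm_tuple [x] = frag_of [x]"
  "norm_tuple [x, x] = 0"
  "distinct_adj xs \<Longrightarrow> xs \<noteq> [] \<Longrightarrow> norm_tuple xs = frag_of xs"
  by (auto simp: norm_tuple_def)

lemma RC_boundary_edge: "RC_boundary (norm_tuple [x, y]) = frag_of [y] - frag_of [x]"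
  by (cases "x = y") (auto simp: norm_tuple_def RC_boundary_def lessThan_Suc)

lemma RC_boundary_triangle:
  "distinct_adj [x, y, z] \<Longrightarrow>
    RC_boundary (frag_of [x, y, z]) = norm_tuple [y, z] - norm_tuple [x, z] + norm_tuple [x, y]"
  by (simp add: RC_boundary_def lessThan_Suc)

lemma normalized_chains_closed [simp]:
  "0 \<in> normalized_chains K n"
  "a \<in> normalized_chains K n \<Longrightarrow> b \<in> normalized_chains K n \<Longrightarrow> a + b \<in> normalized_chains K n"
  "a \<in> normalized_chains K n \<Longrightarrow> b \<in> normalized_chains K n \<Longrightarrow> a - b \<in> normalized_chains K n"
  "a \<in> normalized_chains K n \<Longrightarrow> - a \<in> normalized_chains K n"
  unfolding normalized_chains_def carrier_free_Abelian_group_iff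
  using keys_add [of a b] keys_diff [of a b] by auto

lemma boundariesE:
  assumes "c \<in> boundaries K"
  obtains b where "b \<in> normalized_chains K 2" "c = RC_boundary b"
  using assms unfolding boundaries_def by blast

lemma boundariesI: "b \<in> normalized_chains K 2 \<Longrightarrow> RC_boundary b \<in> boundaries K"
  unfolding boundaries_def by blast

lemma boundaries_closed [simp]:
  "0 \<in> boundaries K"
  "a \<in> boundaries K \<Longrightarrow> b \<in> boundaries K \<Longrightarrow> a + b \<in> boundaries K"
  "a \<in> boundaries K \<Longrightarrow> b \<in> boundaries K \<Longrightarrow> a - b \<in> boundaries K"
  "a \<in> boundaries K \<Longrightarrow> - a \<in> boundaries K"
  using boundariesI [of 0 K] boundariesI [of _ K, OF normalized_chains_closed(2)]
    boundariesI [of _ K, OF normalized_chains_closed(3)] boundariesI [of _ K, OF normalized_chains_closed(4)]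
  by (auto elim!: boundariesE)

lemma subgroup_free_Abelian_groupI:
  assumes "0 \<in> Z" "\<And>a b. a \<in> Z \<Longrightarrow> b \<in> Z \<Longrightarrow> a - b \<in> Z"
  shows "subgroup Z (free_Abelian_group UNIV)"
proof -
  have "- a \<in> Z" if "a \<in> Z" for a
    using assms(2) [OF assms(1) that] by simp
  moreover from this have "a + b \<in> Z" if "a \<in> Z" "b \<in> Z" for a b
    using assms(2) [of a "- b"] that by simp
  ultimately show ?thesis
    using assms(1) by unfold_locales auto
qed

lemma subgroup_cycles: "subgroup (cycles K) (free_Abelian_group UNIV)"
  by (rule subgroup_free_Abelian_groupI) (auto simp: cycles_def)

lemma subgroup_boundaries: "subgroup (boundaries K) (free_Abelian_group UNIV)"
  by (rule subgroup_free_Abelian_groupI) auto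

context edge_path_complex
begin

lemma edge_chain: "[x, y] \<in> K 1 \<Longrightarrow> norm_tuple [x, y] \<in> normalized_chains K 1"
  by (cases "x = y") (auto simp: norm_tuple_def normalized_chains_def)

text \<open>
  The edge case ranges over degenerate edges as well, on which \<open>norm_tuple\<close> vanishes; so proofs by
  this rule make no case distinction on equal vertices. The induction rule for boundaries below
  treats triangles in the same way.
\<close>

lemma chains_1_induct [consumes 1, case_names zero edge diff]:
  assumes "c \<in> normalized_chains K 1" "P 0"
    and "\<And>x y. [x, y] \<in> K 1 \<Longrightarrow> P (norm_tuple [x, y])"
    and "\<And>a b. P a \<Longrightarrow> P b \<Longrightarrow> P (a - b)"
  shows "P c"
proof -
  have "Poly_Mapping.keys c \<subseteq> {xs \<in> K 1. distinct_adj xs}"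
    using assms(1) by (simp add: normalized_chains_def)
  then show ?thesis
  proof (induction c rule: frag_induction)
    case (one xs)
    then obtain x y where "xs = [x, y]"
      using simplex_length [of xs 1] by (auto simp: length_Suc_conv One_nat_def)
    with one assms(3) [of x y] show ?case by simp
  qed (use assms in auto)
qed

text \<open>
  This also covers degenerate triangles: if two consecutive vertices agree, then two of the three
  terms cancel and the third vanishes. Hence each relation of the edge-path groupoid that comes from
  a 2-simplex, degenerate or not, is a boundary relation.
\<close>

lemma triangle_boundary:
  assumes "[x, y, z] \<in> K 2"
  shows "norm_tuple [y, z] - norm_tuple [x, z] + norm_tuple [x, y] \<in> boundaries K"
proof (cases "distinct_adj [x, y, z]")
  case True
  then have "frag_of [x, y, z] \<in> normalized_chains K 2"
    using assms by (simp add: normalized_chains_def)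
  then show ?thesis
    unfolding boundaries_def RC_boundary_triangle [OF True, symmetric] by blast
next
  case False
  then have "x = y \<or> y = z" by auto
  then show ?thesis by auto
qed

lemma boundaries_induct [consumes 1, case_names zero triangle diff]:
  assumes "c \<in> boundaries K" "P 0"
    and "\<And>x y z. [x, y, z] \<in> K 2 \<Longrightarrow>
           P (norm_tuple [y, z] - norm_tuple [x, z] + norm_tuple [x, y])"
    and "\<And>a b. a \<in> boundaries K \<Longrightarrow> b \<in> boundaries K \<Longrightarrow> P a \<Longrightarrow> P b \<Longrightarrow> P (a - b)"
  shows "P c"
proof -
  obtain b where b: "b \<in> normalized_chains K 2" "c = RC_boundary b"
    using assms(1) by (auto simp: boundaries_def)
  have "Poly_Mapping.keys b \<subseteq> {xs \<in> K 2. distinct_adj xs}"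
    using b(1) by (simp add: normalized_chains_def)
  then have "RC_boundary b \<in> boundaries K \<and> P (RC_boundary b)"
  proof (induction b rule: frag_induction)
    case (one xs)
    then obtain x y z where "xs = [x, y, z]"
      using simplex_length [of xs 2] by (auto simp: length_Suc_conv numeral_2_eq_2 One_nat_def)
    with one assms(3) [of x y z] triangle_boundary [of x y z] show ?case
      using RC_boundary_triangle [of x y z] by simp
  qed (use assms in auto)
  with b show ?thesis by simp
qed

lemma boundaries_subset_cycles: "boundaries K \<subseteq> cycles K"
proof
  fix c assume "c \<in> boundaries K"
  then show "c \<in> cycles K"
  proof (induction rule: boundaries_induct)
    case (triangle x y z)
    then show ?case
      using edges [of x y z] by (simp add: cycles_def RC_boundary_edge edge_chain)
  qed (auto simp: cycles_def)
qed

lemma path_chain_in_chains: "edge_path K x w y \<Longrightarrow> path_chain w \<in> normalized_chains K 1"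
  by (induction rule: edge_path.induct) (simp_all add: edge_chain)

lemma RC_boundary_path_chain:
  "edge_path K x w y \<Longrightarrow> RC_boundary (path_chain w) = frag_of [y] - frag_of [x]"
  by (induction rule: edge_path.induct) (auto simp: RC_boundary_edge)

text \<open>
  Each defining relation of the groupoid holds up to a boundary after passing to chains; only the
  relation of a triangle contributes a nonzero one.
\<close>

lemma path_chain_eq: "edge_path_eq K x y v w \<Longrightarrow> path_chain v - path_chain w \<in> boundaries K"
proof (induction rule: edge_path_eq.induct)
  case (sym x y v w)
  then show ?case using boundaries_closed(4) [of "path_chain v - path_chain w"] by simp
next
  case (trans x y u v w)
  then show ?case
    using boundaries_closed(2) [of "path_chain u - path_chain v" K "path_chain v - path_chain w"] by simp
next
  case (cong x y v v' z w w')
  then show ?case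
    using boundaries_closed(2) [of "path_chain v - path_chain v'" K "path_chain w - path_chain w'"]
    by (simp add: algebra_simps)
next
  case (triangle x y z)
  then show ?case using triangle_boundary [of x y z] by (simp add: algebra_simps)
qed auto

end

section \<open>Recognizing an abelianization\<close>

text \<open>
  Because \<open>H\<close> is commutative, the kernel of \<open>h\<close> contains the derived subgroup; so the
  first isomorphism theorem applies as soon as \<open>h\<close> is onto and the kernel is no larger.
\<close>

lemma is_abelianizationI:
  assumes "group G" "comm_group H" and hom: "h \<in> hom G H"
    and onto: "carrier H \<subseteq> h ` carrier G"
    and ker: "\<And>g. g \<in> carrier G \<Longrightarrow> h g = \<one>\<^bsub>H\<^esub> \<Longrightarrow> g \<in> derived G (carrier G)"
  shows "is_abelianization G H h"
proof -
  interpret H: comm_group H by fact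
  interpret group_hom G H h
    using assms by (simp add: group_hom_def group_hom_axioms_def H.is_group)
  have img: "h ` carrier G = carrier H"
    using onto by auto
  have "h ` derived G (carrier G) = {\<one>\<^bsub>H\<^esub>}"
    using derived_img [of "carrier G"] H.derived_eq_singleton [of "carrier H"] img by simp
  moreover have "derived G (carrier G) \<subseteq> carrier G"
    by (simp add: G.derived_in_carrier)
  ultimately have kernel_eq: "kernel G H h = derived G (carrier G)"
    using ker by (auto simp: kernel_def)
  define \<phi> where "\<phi> = (\<lambda>X. the_elem (h ` X))"
  have "\<phi> \<in> iso (G Mod derived G (carrier G)) H"
    using FactGroup_iso_set [OF img] by (simp add: \<phi>_def kernel_eq)
  moreover have "\<phi> (derived G (carrier G) #>\<^bsub>G\<^esub> g) = h g" if g: "g \<in> carrier G" for g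
  proof -
    have "h ` (kernel G H h #>\<^bsub>G\<^esub> g) = {h g}"
      using g one_closed by (force simp: r_coset_def kernel_def)
    then show ?thesis by (simp add: \<phi>_def kernel_eq)
  qed
  ultimately show ?thesis
    unfolding is_abelianization_def using group_hom_axioms by blast
qed

section \<open>The Hurewicz theorem in degree one\<close>

context edge_path_complex
begin

text \<open>
  This is injectivity in the Hurewicz theorem. The class of a loop in the abelianized group \<open>A\<close>
  can be recovered from its chain: join every vertex \<open>x\<close> to the base point by a path \<open>\<tau> x\<close> and
  send an edge from \<open>x\<close> to \<open>y\<close> to the class of the loop \<open>\<tau> x\<close>, then the edge, then the inverse
  of \<open>\<tau> y\<close>. As \<open>A\<close> is commutative, this extends to a homomorphism \<open>\<psi>\<close> on 1-chains. The
  relation of a triangle says that \<open>\<psi>\<close> kills its boundary, and along a loop the auxiliary paths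
  cancel, so that \<open>\<psi>\<close> maps the chain of a loop to the class of that loop. A loop whose chain is a
  boundary therefore has trivial class in \<open>A\<close>.
\<close>

lemma null_homologous_imp_derived:
  assumes x0: "[x0] \<in> K 0"
    and conn: "\<And>x. [x] \<in> K 0 \<Longrightarrow> \<exists>w. edge_path K x0 w x"
    and w: "edge_path K x0 w x0" and null: "path_chain w \<in> boundaries K"
  shows "loop_class x0 w \<in> derived (vertex_group K x0) (carrier (vertex_group K x0))"
proof -
  define G where "G = vertex_group K x0"
  define D where "D = derived G (carrier G)"
  define A where "A = G Mod D"
  interpret G: group G
    unfolding G_def by (rule group_vertex_group [OF x0])
  interpret D: normal D G
    unfolding D_def by (rule G.derived_self_is_normal)
  interpret A: comm_group A
    unfolding A_def D_def by (rule G.derived_quot_is_comm_group)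
  define q where "q = (\<lambda>w. D #>\<^bsub>G\<^esub> loop_class x0 w)"
  have loop: "loop_class x0 w \<in> carrier G" if "edge_path K x0 w x0" for w
    using that by (auto simp: G_def vertex_group_simps)
  have q_closed: "q w \<in> carrier A" if "edge_path K x0 w x0" for w
    using loop [OF that] by (auto simp: q_def A_def carrier_FactGroup)
  have q_mult: "q (v @ w) = q v \<otimes>\<^bsub>A\<^esub> q w" if "edge_path K x0 v x0" "edge_path K x0 w x0" for v w
    using D.rcos_sum [OF loop [OF that(1)] loop [OF that(2)]] that
    by (simp add: q_def A_def G_def vertex_group_simps)
  have q_eq: "q v = q w" if "edge_path_eq K x0 x0 v w" for v w
    using that edge_path_class_eq_iff edge_path_eq_imp_edge_path unfolding q_def by metis
  have q_Nil: "q [] = \<one>\<^bsub>A\<^esub>"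
    by (simp add: q_def A_def G_def vertex_group_simps(2) [symmetric])
       (metis D.subset G.coset_mult_one G_def)
  define \<tau> where "\<tau> = (\<lambda>x. SOME w. edge_path K x0 w x)"
  have \<tau>: "edge_path K x0 (\<tau> x) x" if "[x] \<in> K 0" for x
    unfolding \<tau>_def by (rule someI_ex [OF conn [OF that]])
  \<comment> \<open>The class in \<open>A\<close> of an arbitrary path, closed up to a loop by the auxiliary paths. It is
      multiplicative under concatenation and respects the groupoid relations.\<close>
  define \<Phi> where "\<Phi> = (\<lambda>x w y. q (\<tau> x @ w @ inv_path (\<tau> y)))"
  have \<Phi>_loop: "edge_path K x0 (\<tau> x @ w @ inv_path (\<tau> y)) x0" if "edge_path K x w y" for x w y
    using edge_path_vertices [OF that] that by (meson \<tau> edge_path_append edge_path_inv)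
  have \<Phi>_closed: "\<Phi> x w y \<in> carrier A" if "edge_path K x w y" for x w y
    unfolding \<Phi>_def by (rule q_closed [OF \<Phi>_loop [OF that]])
  have \<Phi>_eq: "\<Phi> x v y = \<Phi> x w y" if "edge_path_eq K x y v w" for x v w y
    unfolding \<Phi>_def
    using that edge_path_eq_imp_edge_path edge_path_vertices
    by (intro q_eq edge_path_eq_context) (blast intro: \<tau> edge_path_inv)+
  have \<Phi>_append: "\<Phi> x (v @ w) z = \<Phi> x v y \<otimes>\<^bsub>A\<^esub> \<Phi> y w z"
    if "edge_path K x v y" "edge_path K y w z" for x v y w z
  proof -
    have vs: "[x] \<in> K 0" "[y] \<in> K 0" "[z] \<in> K 0"
      using that edge_path_vertices by blast+
    \<comment> \<open>The detour from \<open>y\<close> to the base point and back is contracted.\<close>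
    have "edge_path_eq K x0 x0 ((\<tau> x @ v) @ (inv_path (\<tau> y) @ \<tau> y) @ (w @ inv_path (\<tau> z)))
            ((\<tau> x @ v) @ [] @ (w @ inv_path (\<tau> z)))"
      using that vs by (intro edge_path_eq_context [where y = y and y' = y] edge_path_inv_left)
        (blast intro: \<tau> edge_path_inv edge_path_append)+
    from q_eq [OF this] show ?thesis
      using q_mult [OF \<Phi>_loop [OF that(1)] \<Phi>_loop [OF that(2)]] by (simp add: \<Phi>_def)
  qed
  have \<Phi>_Nil: "\<Phi> x [] x = \<one>\<^bsub>A\<^esub>" if "[x] \<in> K 0" for x
    using q_eq [OF edge_path_inv_right [OF \<tau> [OF that]]] q_Nil by (simp add: \<Phi>_def)
  have edge_target: "(\<lambda>xs. \<Phi> (xs ! 0) [Fwd (xs ! 0) (xs ! 1)] (xs ! 1)) ` {xs \<in> K 1. distinct_adj xs}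
      \<subseteq> carrier A"
  proof clarify
    fix xs assume xs: "xs \<in> K 1"
    then obtain x y where "xs = [x, y]"
      using simplex_length [of xs 1] by (auto simp: length_Suc_conv One_nat_def)
    with xs show "\<Phi> (xs ! 0) [Fwd (xs ! 0) (xs ! 1)] (xs ! 1) \<in> carrier A"
      by (auto simp: One_nat_def intro!: \<Phi>_closed edge_path_Fwd)
  qed
  obtain \<psi> where \<psi>: "\<psi> \<in> hom (free_Abelian_group {xs \<in> K 1. distinct_adj xs}) A"
    and \<psi>_gen: "\<And>xs. xs \<in> {xs \<in> K 1. distinct_adj xs} \<Longrightarrow>
        \<psi> (frag_of xs) = \<Phi> (xs ! 0) [Fwd (xs ! 0) (xs ! 1)] (xs ! 1)"
    by (rule A.free_Abelian_group_universal [OF edge_target]) (rule that)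
  interpret \<psi>: group_hom "free_Abelian_group {xs \<in> K 1. distinct_adj xs}" A \<psi>
    using \<psi> by (simp add: group_hom_def group_hom_axioms_def A.is_group)
  have \<psi>_add: "\<psi> (a + b) = \<psi> a \<otimes>\<^bsub>A\<^esub> \<psi> b"
    if "a \<in> normalized_chains K 1" "b \<in> normalized_chains K 1" for a b
    using \<psi>.hom_mult that by (simp add: normalized_chains_def)
  have \<psi>_minus: "\<psi> (- a) = inv\<^bsub>A\<^esub> \<psi> a" if "a \<in> normalized_chains K 1" for a
    using \<psi>.hom_inv [of a] that by (simp add: normalized_chains_def)
  have \<psi>_0: "\<psi> 0 = \<one>\<^bsub>A\<^esub>"
    using \<psi>.hom_one by simp
  have \<psi>_edge: "\<psi> (norm_tuple [x, y]) = \<Phi> x [Fwd x y] y" if "[x, y] \<in> K 1" for x y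
  proof (cases "x = y")
    case True
    have "[x] \<in> K 0" using that vertices by blast
    then show ?thesis
      using True \<Phi>_eq [OF edge_path_eq.degenerate [of x K]] \<Phi>_Nil \<psi>_0 by simp
  next
    case False
    then show ?thesis
      using \<psi>_gen [of "[x, y]"] that by (simp add: One_nat_def)
  qed
  have \<psi>_path: "\<psi> (path_chain w) = \<Phi> x w y" if "edge_path K x w y" for x w y
    using that
  proof (induction rule: edge_path.induct)
    case (Nil x)
    then show ?case by (simp add: \<psi>_0 \<Phi>_Nil)
  next
    case (Fwd x y w z)
    then show ?case
      using \<Phi>_append [OF edge_path_Fwd [OF Fwd.hyps(1)] Fwd.hyps(2)]
      by (simp add: \<psi>_add \<psi>_edge edge_chain path_chain_in_chains)
  next
    case (Bwd x y w z)
    note p = edge_path_Fwd [OF Bwd.hyps(1)] edge_path_Bwd [OF Bwd.hyps(1)]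
    have "\<Phi> y [Bwd x y] x \<otimes>\<^bsub>A\<^esub> \<Phi> x [Fwd x y] y = \<one>\<^bsub>A\<^esub>"
      using \<Phi>_append [OF p(2) p(1)] \<Phi>_eq [OF edge_path_eq.inv_left [of x y K]]
        \<Phi>_Nil [of y] vertices Bwd.hyps(1) by simp
    then have "inv\<^bsub>A\<^esub> (\<Phi> x [Fwd x y] y) = \<Phi> y [Bwd x y] x"
      using p by (intro A.inv_equality) (auto intro: \<Phi>_closed)
    then show ?case
      using \<Phi>_append [OF p(2) Bwd.hyps(2)] Bwd
        \<psi>_add [of "- norm_tuple [x, y]" "path_chain w"] \<psi>_minus [of "norm_tuple [x, y]"]
      by (simp add: \<psi>_edge edge_chain path_chain_in_chains)
  qed
  have \<psi>_boundary: "\<psi> c = \<one>\<^bsub>A\<^esub>" if "c \<in> boundaries K" for c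
    using that
  proof (induction rule: boundaries_induct)
    case zero
    then show ?case by (rule \<psi>_0)
  next
    case (triangle x y z)
    then have e: "[x, y] \<in> K 1" "[y, z] \<in> K 1" "[x, z] \<in> K 1"
      using edges by blast+
    have "\<Phi> x [Fwd x y] y \<otimes>\<^bsub>A\<^esub> \<Phi> y [Fwd y z] z = \<Phi> x [Fwd x z] z"
      using \<Phi>_append [OF edge_path_Fwd [OF e(1)] edge_path_Fwd [OF e(2)]]
        \<Phi>_eq [OF edge_path_eq.triangle [of x y z K]] triangle by simp
    moreover have "norm_tuple [y, z] - norm_tuple [x, z] + norm_tuple [x, y]
        = (norm_tuple [x, y] + norm_tuple [y, z]) + - norm_tuple [x, z]"
      by simp
    ultimately show ?case
      using e by (simp only: \<psi>_add \<psi>_minus \<psi>_edge edge_chain normalized_chains_closed)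
        (simp add: \<Phi>_closed edge_path_Fwd)
  next
    case (diff a b)
    then have "a \<in> normalized_chains K 1" "b \<in> normalized_chains K 1"
      using boundaries_subset_cycles by (auto simp: cycles_def)
    then show ?case
      using \<psi>_add [of a "- b"] diff by (simp add: \<psi>_minus)
  qed
  \<comment> \<open>Closing up \<open>w\<close> conjugates it by the loop \<open>\<tau> x0\<close>, which is trivial in \<open>A\<close>.\<close>
  have "q w = \<Phi> x0 w x0"
  proof -
    have \<tau>0: "edge_path K x0 (\<tau> x0) x0" "edge_path K x0 (inv_path (\<tau> x0)) x0"
      using \<tau> x0 edge_path_inv by blast+
    have "\<Phi> x0 w x0 = q (\<tau> x0) \<otimes>\<^bsub>A\<^esub> (q w \<otimes>\<^bsub>A\<^esub> q (inv_path (\<tau> x0)))"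
      using w \<tau>0 by (simp add: \<Phi>_def q_mult edge_path_append [of K x0 _ x0])
    also have "\<dots> = q w \<otimes>\<^bsub>A\<^esub> (q (\<tau> x0) \<otimes>\<^bsub>A\<^esub> q (inv_path (\<tau> x0)))"
      using w \<tau>0 by (intro A.m_lcomm) (auto intro: q_closed)
    also have "q (\<tau> x0) \<otimes>\<^bsub>A\<^esub> q (inv_path (\<tau> x0)) = \<one>\<^bsub>A\<^esub>"
      using q_mult [OF \<tau>0] q_eq [OF edge_path_inv_right [OF \<tau>0(1)]] q_Nil by simp
    finally show ?thesis using q_closed [OF w] by simp
  qed
  also have "\<dots> = D"
    using \<psi>_path [OF w] \<psi>_boundary [OF null] by (simp add: A_def)
  finally have "loop_class x0 w \<in> D"
    unfolding q_def using G.rcos_self [OF loop [OF w] D.subgroup_axioms] by simp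
  then show ?thesis by (simp add: D_def G_def)
qed

text \<open>
  This is surjectivity in the Hurewicz theorem. Let \<open>T\<close> be the linear map that sends a vertex \<open>x\<close>
  to the chain of an auxiliary path from the base point to \<open>x\<close>. The edge from \<open>x\<close> to \<open>y\<close>,
  closed up to a loop by the auxiliary paths, has chain \<open>e - T (\<partial> e)\<close> where \<open>e\<close> is the chain of
  the edge. Chains of loops form a group, so \<open>c - T (\<partial> c)\<close> is the chain of a loop for every
  1-chain \<open>c\<close>, and on cycles the second term vanishes.
\<close>

lemma cycle_is_chain_of_loop:
  assumes x0: "[x0] \<in> K 0"
    and conn: "\<And>x. [x] \<in> K 0 \<Longrightarrow> \<exists>w. edge_path K x0 w x"
    and c: "c \<in> cycles K"
  shows "\<exists>w. edge_path K x0 w x0 \<and> path_chain w = c"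
proof -
  define \<tau> where "\<tau> = (\<lambda>x. SOME w. edge_path K x0 w x)"
  have \<tau>: "edge_path K x0 (\<tau> x) x" if "[x] \<in> K 0" for x
    unfolding \<tau>_def by (rule someI_ex [OF conn [OF that]])
  define T where "T = frag_extend (\<lambda>xs. path_chain (\<tau> (hd xs)))"
  have "\<exists>w. edge_path K x0 w x0 \<and> path_chain w = c - T (RC_boundary c)"
    if "c \<in> normalized_chains K 1" for c
    using that
  proof (induction rule: chains_1_induct)
    case zero
    then show ?case using edge_path.Nil [of x0 K] x0 by (auto simp: T_def)
  next
    case (edge x y)
    then have "[x] \<in> K 0" "[y] \<in> K 0" using vertices by blast+
    then have "edge_path K x0 (\<tau> x @ [Fwd x y] @ inv_path (\<tau> y)) x0"
      using edge by (meson \<tau> edge_path_append edge_path_inv edge_path_Fwd)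
    moreover have "path_chain (\<tau> x @ [Fwd x y] @ inv_path (\<tau> y))
        = norm_tuple [x, y] - T (RC_boundary (norm_tuple [x, y]))"
      by (simp add: RC_boundary_edge T_def frag_extend_diff)
    ultimately show ?case by blast
  next
    case (diff a b)
    then obtain v w where "edge_path K x0 v x0" "path_chain v = a - T (RC_boundary a)"
      "edge_path K x0 w x0" "path_chain w = b - T (RC_boundary b)" by blast
    then have "edge_path K x0 (v @ inv_path w) x0"
      "path_chain (v @ inv_path w) = (a - b) - T (RC_boundary (a - b))"
      by (auto simp: T_def frag_extend_diff intro: edge_path_append edge_path_inv)
    then show ?case by blast
  qed
  from this [of c] c show ?thesis by (simp add: cycles_def T_def)
qed

end

text \<open>
  The value at \<open>A\<close> consists of all chains in \<open>Z\<close> that are homologous to a loop in \<open>A\<close>. If \<open>Z\<close>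
  consists of cycles and represents every homology class, this is a coset of the boundaries lying
  in \<open>Z\<close>. The parameter \<open>Z\<close> is there for the spectral sequence, whose classes are represented by
  cycles on arcs only, while a loop may run through longer edges.
\<close>

definition hurewicz_map ::
    "(nat \<Rightarrow> 'a list set) \<Rightarrow> ('a list \<Rightarrow>\<^sub>0 int) set \<Rightarrow> 'a edge_step list set \<Rightarrow> ('a list \<Rightarrow>\<^sub>0 int) set" where
  "hurewicz_map K Z A = {c \<in> Z. \<exists>w \<in> A. c - path_chain w \<in> boundaries K}"

context edge_path_complex
begin

text \<open>
  The defining condition can be tested on any one representative of a class, because equivalent
  loops have homologous chains.
\<close>

lemma hurewicz_map_class:
  assumes "edge_path K x w x"
  shows "hurewicz_map K Z (loop_class x w) = {c \<in> Z. c - path_chain w \<in> boundaries K}"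
proof -
  have "c - path_chain w \<in> boundaries K"
    if "edge_path_eq K x x w v" "c - path_chain v \<in> boundaries K" for c v
    using boundaries_closed(3) [OF that(2) path_chain_eq [OF that(1)]]
      boundaries_closed(3) [OF that(2) path_chain_eq [OF edge_path_eq.sym [OF that(1)]]]
    by (metis (no_types, lifting) add_diff_cancel_left' diff_add_cancel diff_diff_eq2)
  moreover have "w \<in> loop_class x w"
    using assms by (simp add: edge_path_class_def edge_path_eq.refl)
  ultimately show ?thesis
    by (auto simp: hurewicz_map_def edge_path_class_def)
qed

lemma hurewicz_map_class_coset:
  assumes w: "edge_path K x w x"
    and Z: "subgroup Z (free_Abelian_group UNIV)"
    and z: "z \<in> Z" "z - path_chain w \<in> boundaries K"
  shows "hurewicz_map K Z (loop_class x w) = (Z \<inter> boundaries K) #>\<^bsub>free_Abelian_group S\<^esub> z"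
proof -
  have Z_closed: "a + b \<in> Z" "a - b \<in> Z" if "a \<in> Z" "b \<in> Z" for a b
    using subgroup.m_closed [OF Z, of a b] subgroup.m_closed [OF Z, of a "- b"]
      subgroup.m_inv_closed [OF Z, of b] that by simp_all
  have "c \<in> (Z \<inter> boundaries K) #>\<^bsub>free_Abelian_group S\<^esub> z \<longleftrightarrow> c - z \<in> Z \<inter> boundaries K" for c
    by (force simp: r_coset_def)
  moreover have "c \<in> Z" "c - path_chain w \<in> boundaries K" if "c - z \<in> Z \<inter> boundaries K" for c
    using Z_closed(1) [of "c - z" z] boundaries_closed(2) [of "c - z" K "z - path_chain w"] that z
    by simp_all
  moreover have "c - z \<in> Z \<inter> boundaries K" if "c \<in> Z" "c - path_chain w \<in> boundaries K" for c
    using Z_closed(2) [of c z] boundaries_closed(3) [of "c - path_chain w" K "z - path_chain w"] that z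
    by simp
  ultimately have "c \<in> (Z \<inter> boundaries K) #>\<^bsub>free_Abelian_group S\<^esub> z
      \<longleftrightarrow> c \<in> Z \<and> c - path_chain w \<in> boundaries K" for c
    by metis
  then show ?thesis
    unfolding hurewicz_map_class [OF w] set_eq_iff by simp
qed

text \<open>
  The subgroup \<open>Z\<close> meets every homology class of cycles, so the target group is the first homology
  group of \<open>K\<close>, presented by representatives in \<open>Z\<close>. A loop has a chain
  in \<open>Z\<close> only up to boundaries, so each value of the map is described by such a representative \<open>z\<close>;
  the two lemmas on auxiliary paths then give injectivity on the abelianization and surjectivity.
\<close>

theorem hurewicz:
  assumes x0: "[x0] \<in> K 0"
    and conn: "\<And>x. [x] \<in> K 0 \<Longrightarrow> \<exists>w. edge_path K x0 w x"
    and Z: "subgroup Z (free_Abelian_group UNIV)" "Z \<subseteq> cycles K"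
    and rep: "\<And>c. c \<in> cycles K \<Longrightarrow> \<exists>z\<in>Z. z - c \<in> boundaries K"
  shows "is_abelianization (vertex_group K x0)
    ((free_Abelian_group S)\<lparr>carrier := Z\<rparr> Mod (Z \<inter> boundaries K)) (hurewicz_map K Z)"
proof -
  define F where "F = (free_Abelian_group S)\<lparr>carrier := Z\<rparr>"
  define B where "B = Z \<inter> boundaries K"
  have F_eq: "F = (free_Abelian_group UNIV)\<lparr>carrier := Z\<rparr>"
    by (simp add: F_def free_Abelian_group_def)
  have F_simps: "carrier F = Z" "\<And>a b. a \<otimes>\<^bsub>F\<^esub> b = a + b"
    by (simp_all add: F_def)
  interpret FA: comm_group "free_Abelian_group UNIV"
    by (rule abelian_free_Abelian_group)
  interpret F: group F
    unfolding F_eq by (rule FA.subgroup_imp_group [OF Z(1)])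
  interpret F: comm_group F
    by (rule F.group_comm_groupI) (simp add: F_simps add.commute)
  have sub: "subgroup B F"
    unfolding F_eq B_def
    by (intro FA.subgroup_incl FA.subgroups_Inter_pair Z(1) subgroup_boundaries) auto
  interpret B: normal B F
    using F.normal_iff_subgroup sub by blast
  interpret Q: comm_group "F Mod B"
    by (rule F.abelian_FactGroup [OF sub])
  have coset: "hurewicz_map K Z (loop_class x0 w) = B #>\<^bsub>F\<^esub> z"
    if "edge_path K x0 w x0" "z \<in> Z" "z - path_chain w \<in> boundaries K" for w z
    using hurewicz_map_class_coset [OF that(1) Z(1) that(2,3)]
    by (simp add: B_def F_def r_coset_def)
  have rep_loop: "\<exists>z\<in>Z. z - path_chain w \<in> boundaries K" if "edge_path K x0 w x0" for w
    using that by (intro rep) (simp add: cycles_def path_chain_in_chains RC_boundary_path_chain)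
  show ?thesis
    unfolding F_def [symmetric] B_def [symmetric]
  proof (rule is_abelianizationI)
    show "group (vertex_group K x0)" by (rule group_vertex_group [OF x0])
    show "comm_group (F Mod B)" ..
    show "hurewicz_map K Z \<in> hom (vertex_group K x0) (F Mod B)"
    proof (rule homI)
      fix A assume "A \<in> carrier (vertex_group K x0)"
      then obtain w where w: "A = loop_class x0 w" "edge_path K x0 w x0"
        by (auto simp: vertex_group_simps)
      then show "hurewicz_map K Z A \<in> carrier (F Mod B)"
        using rep_loop [OF w(2)] coset [OF w(2)] by (auto simp: carrier_FactGroup F_simps)
    next
      fix A A' assume "A \<in> carrier (vertex_group K x0)" "A' \<in> carrier (vertex_group K x0)"
      then obtain v w where vw: "A = loop_class x0 v" "edge_path K x0 v x0"
        "A' = loop_class x0 w" "edge_path K x0 w x0"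
        by (auto simp: vertex_group_simps)
      obtain y z where yz: "y \<in> Z" "y - path_chain v \<in> boundaries K"
        "z \<in> Z" "z - path_chain w \<in> boundaries K"
        using rep_loop vw by blast
      have "y + z \<in> Z"
        using F.m_closed yz by (simp add: F_simps)
      moreover have "y + z - path_chain (v @ w) \<in> boundaries K"
        using boundaries_closed(2) [OF yz(2,4)] by (simp add: algebra_simps)
      ultimately have "hurewicz_map K Z (loop_class x0 (v @ w)) = B #>\<^bsub>F\<^esub> (y \<otimes>\<^bsub>F\<^esub> z)"
        using coset [of "v @ w" "y + z"] vw edge_path_append F_simps by metis
      also have "\<dots> = (B #>\<^bsub>F\<^esub> y) <#>\<^bsub>F\<^esub> (B #>\<^bsub>F\<^esub> z)"
        using B.rcos_sum [of y z] yz by (simp add: F_simps)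
      finally show "hurewicz_map K Z (A \<otimes>\<^bsub>vertex_group K x0\<^esub> A')
          = hurewicz_map K Z A \<otimes>\<^bsub>F Mod B\<^esub> hurewicz_map K Z A'"
        using vw coset yz by (simp add: vertex_group_simps)
    qed
    show "carrier (F Mod B) \<subseteq> hurewicz_map K Z ` carrier (vertex_group K x0)"
    proof
      fix C assume "C \<in> carrier (F Mod B)"
      then obtain z where z: "z \<in> Z" "C = B #>\<^bsub>F\<^esub> z"
        by (auto simp: carrier_FactGroup F_simps)
      then obtain w where w: "edge_path K x0 w x0" "path_chain w = z"
        using cycle_is_chain_of_loop [OF x0 conn] Z(2) by blast
      have "C = hurewicz_map K Z (loop_class x0 w)"
        using coset [OF w(1) z(1)] z(2) w(2) by simp
      then show "C \<in> hurewicz_map K Z ` carrier (vertex_group K x0)"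
        using w(1) by (auto simp: vertex_group_simps)
    qed
    fix A assume A: "A \<in> carrier (vertex_group K x0)" "hurewicz_map K Z A = \<one>\<^bsub>F Mod B\<^esub>"
    then obtain w where w: "A = loop_class x0 w" "edge_path K x0 w x0"
      by (auto simp: vertex_group_simps)
    have "0 \<in> hurewicz_map K Z A"
      using A(2) B.one_closed by (simp add: F_def)
    then have "path_chain w \<in> boundaries K"
      using boundaries_closed(4) [of "- path_chain w" K]
      by (simp add: w hurewicz_map_class)
    then show "A \<in> derived (vertex_group K x0) (carrier (vertex_group K x0))"
      unfolding w(1) using null_homologous_imp_derived [OF x0 conn w(2)] by blast
  qed
qed

end

section \<open>Induced maps on chains\<close>

lemma RC_map_linear [simp]:
  "RC_map f 0 = 0"
  "RC_map f (a + b) = RC_map f a + RC_map f b"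
  "RC_map f (a - b) = RC_map f a - RC_map f b"
  "RC_map f (- a) = - RC_map f a"
  by (simp_all add: RC_map_def frag_extend_add frag_extend_diff frag_extend_minus)

lemma RC_map_edge: "RC_map f (norm_tuple [x, y]) = norm_tuple [f x, f y]"
  by (cases "x = y") (simp_all add: RC_map_def)

lemma RC_map_path_chain: "RC_map f (path_chain w) = path_chain (map (map_edge_step f) w)"
proof (induction w)
  case (Cons s w)
  then show ?case by (cases s) (simp_all add: RC_map_edge)
qed simp

lemma RC_map_boundaries:
  assumes "edge_path_complex K" "edge_path_complex K'"
    and f: "\<And>n xs. xs \<in> K n \<Longrightarrow> map f xs \<in> K' n"
    and c: "c \<in> boundaries K"
  shows "RC_map f c \<in> boundaries K'"
proof -
  interpret K: edge_path_complex K by fact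
  interpret K': edge_path_complex K' by fact
  show ?thesis
    using c
  proof (induction rule: K.boundaries_induct)
    case (triangle x y z)
    then show ?case
      using K'.triangle_boundary [of "f x" "f y" "f z"] f [of "[x, y, z]" 2]
      by (simp add: RC_map_edge)
  qed simp_all
qed

section \<open>Distances and tuple lengths\<close>

lemma ddist_le: "(x, y) \<in> parcs X ^^ n \<Longrightarrow> ddist X x y \<le> enat n"
  unfolding ddist_def by (rule INF_lower) simp

lemma ddist_attained:
  assumes "ddist X x y < \<infinity>"
  obtains n where "ddist X x y = enat n" "(x, y) \<in> parcs X ^^ n"
proof -
  let ?S = "enat ` {n. (x, y) \<in> parcs X ^^ n}"
  have "?S \<noteq> {}"
    using assms by (auto simp: ddist_def Inf_enat_def split: if_splits)
  then have "Inf ?S \<in> ?S"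
    unfolding Inf_enat_def by (auto intro: LeastI)
  then show thesis
    using that by (auto simp: ddist_def)
qed

lemma ddist_self [simp]: "ddist X x x = 0"
  using ddist_le [of x x 0 X] by (simp add: zero_enat_def [symmetric])

lemma ddist_triangle: "ddist X x z \<le> ddist X x y + ddist X y z"
proof (cases "ddist X x y < \<infinity> \<and> ddist X y z < \<infinity>")
  case True
  then obtain m n where "ddist X x y = enat m" "(x, y) \<in> parcs X ^^ m"
    "ddist X y z = enat n" "(y, z) \<in> parcs X ^^ n"
    by (metis ddist_attained)
  then show ?thesis
    using ddist_le [of x z "m + n" X] by (auto simp: relpow_add)
qed auto

lemma ddist_eq_0_imp_eq: "ddist X x y = 0 \<Longrightarrow> x = y"
  by (rule ddist_attained [of X x y]) (auto simp: zero_enat_def)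

text \<open>
  An arc is sent to an arc or collapsed to a vertex, so that directed paths do not get longer.
\<close>

lemma ddist_map:
  assumes "pointed_digraph_map X x0 Y y0 f"
  shows "ddist Y (f x) (f y) \<le> ddist X x y"
proof (cases "ddist X x y < \<infinity>")
  case True
  have "ddist Y (f x) (f y) \<le> enat n" if "(x, y) \<in> parcs X ^^ n" for n
    using that
  proof (induction n arbitrary: y)
    case 0
    then show ?case by simp
  next
    case (Suc n)
    then obtain u where u: "(x, u) \<in> parcs X ^^ n" "(u, y) \<in> parcs X" by auto
    then have "(f u, f y) \<in> parcs Y \<or> f u = f y"
      using assms unfolding pointed_digraph_map_def by blast
    then have "ddist Y (f u) (f y) \<le> enat 1"
      using ddist_le [of "f u" "f y" 1 Y] by auto
    then have "ddist Y (f x) (f u) + ddist Y (f u) (f y) \<le> enat n + enat 1"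
      by (intro add_mono Suc.IH u)
    then show ?case
      using ddist_triangle [of Y "f x" "f y" "f u"] by (simp add: One_nat_def)
  qed
  with True show ?thesis
    by (metis ddist_attained)
qed auto

lemma tuple_length_simps [simp]:
  "tuple_length X [] = 0"
  "tuple_length X [x] = 0"
  "tuple_length X [x, y] = ddist X x y"
  "tuple_length X [x, y, z] = ddist X x y + ddist X y z"
  by (simp_all add: tuple_length_def lessThan_Suc One_nat_def add.commute)

lemma tuple_length_map:
  assumes "pointed_digraph_map X x0 Y y0 f"
  shows "tuple_length Y (map f xs) \<le> tuple_length X xs"
  unfolding tuple_length_def length_map
  by (rule sum_mono) (auto intro: ddist_map [OF assms])

section \<open>Nerves of digraphs\<close>

lemma nerve_vertex: "[x] \<in> nerve r X 0 \<longleftrightarrow> x \<in> pverts X"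
  unfolding nerve_def mem_Collect_eq tuple_length_simps
  using i0_lb [of r] by (auto simp: zero_enat_def)

lemma nerve_edge:
  "[x, y] \<in> nerve r X 1 \<longleftrightarrow>
    x \<in> pverts X \<and> y \<in> pverts X \<and> ddist X x y \<le> r \<and> ddist X x y < \<infinity>"
  unfolding nerve_def mem_Collect_eq tuple_length_simps by (auto simp: One_nat_def)

lemma nerve_triangle:
  "[x, y, z] \<in> nerve r X 2 \<longleftrightarrow> x \<in> pverts X \<and> y \<in> pverts X \<and> z \<in> pverts X \<and>
    ddist X x y + ddist X y z \<le> r \<and> ddist X x y + ddist X y z < \<infinity>"
  unfolding nerve_def mem_Collect_eq tuple_length_simps by auto

lemma edge_path_complex_nerve: "edge_path_complex (nerve r X)"
proof
  fix x y z
  assume xyz: "[x, y, z] \<in> nerve r X 2"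
  let ?l = "ddist X x y + ddist X y z"
  have "d \<le> r \<and> d < \<infinity>" if "d \<le> ?l" for d
    using that xyz unfolding nerve_triangle by (meson order.trans order.strict_trans1)
  moreover have "ddist X x y \<le> ?l" "ddist X y z \<le> ?l"
    by simp_all
  ultimately show "[x, y] \<in> nerve r X 1 \<and> [y, z] \<in> nerve r X 1 \<and> [x, z] \<in> nerve r X 1"
    using xyz ddist_triangle [of X x z y] unfolding nerve_edge nerve_triangle by blast
next
  fix x assume "[x] \<in> nerve r X 0"
  then show "[x, x] \<in> nerve r X 1"
    unfolding nerve_vertex nerve_edge using i0_lb [of r] by (simp add: zero_enat_def)
qed (auto simp: nerve_vertex nerve_edge, simp add: nerve_def)

lemma nerve_mono: "r \<le> r' \<Longrightarrow> nerve r X n \<subseteq> nerve r' X n"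
  by (auto simp: nerve_def)

lemma arc_in_nerve:
  assumes "pair_wf_digraph X" "(x, y) \<in> parcs X" "1 \<le> r"
  shows "[x, y] \<in> nerve r X 1"
proof -
  interpret pair_wf_digraph X by fact
  have "ddist X x y \<le> 1"
    using ddist_le [of x y 1 X] assms(2) by (simp add: one_enat_def)
  moreover have "1 < (\<infinity>::enat)"
    by (simp add: one_enat_def)
  ultimately have "ddist X x y \<le> r" "ddist X x y < \<infinity>"
    using assms(3) by (meson order.trans order.strict_trans1)+
  then show ?thesis
    using assms(2) in_arcsD1 in_arcsD2 by (simp add: nerve_edge)
qed

lemma nerve_map:
  assumes "pointed_digraph_map X x0 Y y0 f" "xs \<in> nerve r X n"
  shows "map f xs \<in> nerve r Y n"
proof -
  have "f ` pverts X \<subseteq> pverts Y"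
    using assms(1) by (simp add: pointed_digraph_map_def)
  moreover have "tuple_length Y (map f xs) \<le> r" "tuple_length Y (map f xs) < \<infinity>"
    using tuple_length_map [OF assms(1), of xs] assms(2) unfolding nerve_def mem_Collect_eq
    by (meson order.trans order.strict_trans1)+
  ultimately show ?thesis
    using assms(2) unfolding nerve_def by auto
qed

text \<open>
  Arcs are edges of the nerve as soon as \<open>1 \<le> r\<close>, so a zig-zag of arcs is an edge path.
\<close>

lemma nerve_connected:
  assumes "conn_pointed_digraph X x0" "1 \<le> r" "[x] \<in> nerve r X 0"
  shows "\<exists>w. edge_path (nerve r X) x0 w x"
proof -
  interpret edge_path_complex "nerve r X" by (rule edge_path_complex_nerve)
  have wf: "pair_wf_digraph X"
    using assms(1) by (simp add: conn_pointed_digraph_def pair_loopfree_digraph_def)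
  have "x0 \<rightarrow>\<^sup>*\<^bsub>with_proj (mk_symmetric (with_proj X))\<^esub> x"
    using assms by (auto simp: conn_pointed_digraph_def connected_def strongly_connected_def nerve_vertex)
  then have "(x0, x) \<in> rtrancl_on (pverts X) (parcs (mk_symmetric (with_proj X)))"
    by (simp add: reachable_def)
  then show ?thesis
  proof (induction rule: rtrancl_on.induct)
    case (rtrancl_on_refl a)
    then show ?case by (auto intro!: exI [of _ "[]"] edge_path.Nil simp: nerve_vertex)
  next
    case (rtrancl_on_into_rtrancl_on a b c)
    then obtain w where w: "edge_path (nerve r X) a w b" by blast
    have "(b, c) \<in> parcs X \<or> (c, b) \<in> parcs X"
      using rtrancl_on_into_rtrancl_on by (auto simp: parcs_mk_symmetric)
    then have "[b, c] \<in> nerve r X 1 \<or> [c, b] \<in> nerve r X 1"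
      using arc_in_nerve [OF wf _ assms(2)] by blast
    then show ?case
      using edge_path_append [OF w edge_path_Fwd] edge_path_append [OF w edge_path_Bwd] by blast
  qed
qed

section \<open>The groups of the spectral sequence and reachability homology\<close>

lemma RC_filt_eq: "RC_filt X (int p) (int n) = normalized_chains (nerve (enat p) X) n"
proof -
  have "{xs \<in> RC_gens X (int n). \<exists>k. tuple_length X xs = enat k \<and> int k \<le> int p}
      = {xs \<in> nerve (enat p) X n. distinct_adj xs}"
    by (auto simp: RC_gens_def nerve_def)
  then show ?thesis
    by (simp add: RC_filt_def normalized_chains_def)
qed

lemma RC_filt_neg: "p < 0 \<Longrightarrow> RC_filt X p n = {0}"
  by (auto simp: RC_filt_def)

lemma RC_filt_0_1: "RC_filt X 0 1 = {0}"
proof -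
  have False if "xs \<in> nerve 0 X 1" "distinct_adj xs" for xs
  proof -
    have "length xs = 1 + 1"
      using that(1) unfolding nerve_def by blast
    then obtain x y where "xs = [x, y]"
      by (auto simp: length_Suc_conv One_nat_def)
    with that show False
      using ddist_eq_0_imp_eq [of X x y] by (simp add: nerve_def)
  qed
  then have empty: "{xs \<in> nerve 0 X 1. distinct_adj xs} = {}" by blast
  have "normalized_chains (nerve 0 X) 1 = {0}"
    unfolding normalized_chains_def empty by auto
  then show ?thesis
    using RC_filt_eq [of X 0 1] by (simp add: zero_enat_def [symmetric])
qed

lemma RC_carrier_eq: "carrier (RC X (int n)) = normalized_chains (nerve \<infinity> X) n"
  by (simp add: RC_def RC_gens_def normalized_chains_def)

text \<open>
  For \<open>2 \<le> r\<close> the boundary of an element would lie in filtration degree \<open>1 - r < 0\<close>, hence it is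
  zero. So from the second page on, the numerator consists of the cycles supported on tuples
  \<open>(x, y)\<close> of length one, that is, on arcs.
\<close>

lemma MPSS_Z_eq:
  assumes "2 \<le> r"
  shows "MPSS_Z X r 1 0 = cycles (nerve 1 X)"
  using assms RC_filt_eq [of X 1 1]
  by (auto simp: MPSS_Z_def cycles_def RC_filt_neg one_enat_def)

text \<open>
  A nondegenerate edge has positive length, so the summand from filtration degree \<open>0\<close> vanishes.
  The other summand consists of the boundaries of 2-chains of length at most \<open>r\<close> that happen to be
  supported on arcs.
\<close>

lemma MPSS_B_eq:
  assumes "2 \<le> r"
  shows "MPSS_B X (int r) 1 0 = cycles (nerve 1 X) \<inter> boundaries (nerve (enat r) X)"
proof -
  have 1: "MPSS_Z X (int r - 1) (1 - 1) (0 + 1) = {0}"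
    by (auto simp: MPSS_Z_def RC_filt_0_1) (simp add: RC_filt_def)
  have 2: "MPSS_Z X (int r - 1) (1 + int r - 1) (0 - int r + 2)
      = {b \<in> normalized_chains (nerve (enat r) X) 2. RC_boundary b \<in> normalized_chains (nerve 1 X) 1}"
    using RC_filt_eq [of X r 2] RC_filt_eq [of X 1 1] by (simp add: MPSS_Z_def one_enat_def)
  have "RC_boundary (RC_boundary b) = 0" if "b \<in> normalized_chains (nerve (enat r) X) 2" for b
    using edge_path_complex.boundaries_subset_cycles [OF edge_path_complex_nerve, of "enat r" X]
      boundariesI [OF that] by (auto simp: cycles_def)
  then show ?thesis
    unfolding MPSS_B_def 1 2 by (auto simp: cycles_def boundaries_def)
qed

lemma MPSS_eq:
  assumes "2 \<le> r"
  shows "MPSS X (int r) 1 0 = (RC X 1)\<lparr>carrier := cycles (nerve 1 X)\<rparr>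
    Mod (cycles (nerve 1 X) \<inter> boundaries (nerve (enat r) X))"
  using assms by (simp add: MPSS_def MPSS_Z_eq MPSS_B_eq)

lemma RC_boundaries_eq: "RC_boundaries X 1 = cycles (nerve \<infinity> X) \<inter> boundaries (nerve \<infinity> X)"
proof -
  have "RC_boundaries X 1 = boundaries (nerve \<infinity> X)"
    using RC_carrier_eq [of X 2] by (simp add: RC_boundaries_def boundaries_def)
  then show ?thesis
    using edge_path_complex.boundaries_subset_cycles [OF edge_path_complex_nerve, of \<infinity> X] by blast
qed

lemma RH_eq:
  "RH X 1 = (RC X 1)\<lparr>carrier := cycles (nerve \<infinity> X)\<rparr>
    Mod (cycles (nerve \<infinity> X) \<inter> boundaries (nerve \<infinity> X))"
proof -
  have "RC_cycles X 1 = cycles (nerve \<infinity> X)"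
    using RC_carrier_eq [of X 1] by (simp add: RC_cycles_def cycles_def)
  then show ?thesis by (simp add: RH_def RC_boundaries_eq)
qed

text \<open>
  An edge \<open>(x, y)\<close> is subdivided along a directed path, one arc at a time from its end: if \<open>u\<close> is
  the last vertex before \<open>y\<close>, then \<open>(x, u, y)\<close> is a 2-simplex whose length is at most the number
  of arcs of the path.
\<close>

lemma edge_homologous_to_arcs:
  assumes "pair_wf_digraph X" "x \<in> pverts X" "(x, y) \<in> parcs X ^^ n" "enat n \<le> r"
  shows "\<exists>z \<in> normalized_chains (nerve 1 X) 1. z - norm_tuple [x, y] \<in> boundaries (nerve r X)"
  using assms(3,4)
proof (induction n arbitrary: y)
  case 0
  then show ?case by (intro bexI [of _ 0]) auto
next
  case (Suc n)
  interpret pair_wf_digraph X by fact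
  interpret N1: edge_path_complex "nerve 1 X" by (rule edge_path_complex_nerve)
  interpret Nr: edge_path_complex "nerve r X" by (rule edge_path_complex_nerve)
  obtain u where u: "(x, u) \<in> parcs X ^^ n" "(u, y) \<in> parcs X"
    using Suc.prems by auto
  have "enat n \<le> r"
    using Suc.prems(2) by (meson enat_ord_simps(1) le_SucI order.refl order.trans)
  then obtain z where z: "z \<in> normalized_chains (nerve 1 X) 1"
    "z - norm_tuple [x, u] \<in> boundaries (nerve r X)"
    using Suc.IH [OF u(1)] by blast
  have le: "ddist X x u + ddist X u y \<le> enat (Suc n)"
    using add_mono [OF ddist_le [OF u(1)] ddist_le [of u y 1 X]] u(2) by (simp add: One_nat_def)
  moreover have "ddist X x u + ddist X u y < \<infinity>"
    using le by (meson enat_ord_code(4) order.strict_trans1)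
  moreover have "ddist X x u + ddist X u y \<le> r"
    using le Suc.prems(2) by (rule order.trans)
  ultimately have "[x, u, y] \<in> nerve r X 2"
    using u(2) assms(2) in_arcsD1 in_arcsD2 by (simp add: nerve_triangle)
  then have "(z - norm_tuple [x, u])
      + (norm_tuple [u, y] - norm_tuple [x, y] + norm_tuple [x, u]) \<in> boundaries (nerve r X)"
    using boundaries_closed(2) [OF z(2) Nr.triangle_boundary] by blast
  moreover have "norm_tuple [u, y] \<in> normalized_chains (nerve 1 X) 1"
    using arc_in_nerve [OF assms(1) u(2)] by (intro N1.edge_chain) simp
  ultimately show ?case
    using z(1) by (intro bexI [of _ "z + norm_tuple [u, y]"]) (auto simp: algebra_simps)
qed

text \<open>
  Subdividing every edge of a cycle changes it by a boundary, so the result is again a cycle. For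
  \<open>2 \<le> r < \<infinity>\<close> this identifies \<open>E\<^sup>r\<^sub>1\<^sub>,\<^sub>0\<close> with \<open>H\<^sub>1(N\<^sup>r(X))\<close>.
\<close>

lemma cycle_homologous_to_arc_cycle:
  assumes "pair_wf_digraph X" "c \<in> cycles (nerve r X)"
  shows "\<exists>z \<in> cycles (nerve 1 X). z - c \<in> boundaries (nerve r X)"
proof -
  interpret edge_path_complex "nerve r X" by (rule edge_path_complex_nerve)
  have "\<exists>z \<in> normalized_chains (nerve 1 X) 1. z - c \<in> boundaries (nerve r X)"
    if "c \<in> normalized_chains (nerve r X) 1" for c
    using that
  proof (induction rule: chains_1_induct)
    case zero
    then show ?case by (intro bexI [of _ 0]) auto
  next
    case (edge x y)
    then have "x \<in> pverts X" "ddist X x y < \<infinity>" "ddist X x y \<le> r"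
      by (simp_all add: nerve_edge)
    then show ?case
      using edge_homologous_to_arcs [OF assms(1)] by (metis ddist_attained)
  next
    case (diff a b)
    then obtain y z where yz: "y \<in> normalized_chains (nerve 1 X) 1" "y - a \<in> boundaries (nerve r X)"
      "z \<in> normalized_chains (nerve 1 X) 1" "z - b \<in> boundaries (nerve r X)" by blast
    have "(y - z) - (a - b) \<in> boundaries (nerve r X)"
      using boundaries_closed(3) [OF yz(2,4)] by (simp add: algebra_simps)
    with yz show ?case by (intro bexI [of _ "y - z"]) auto
  qed
  then obtain z where z: "z \<in> normalized_chains (nerve 1 X) 1" "z - c \<in> boundaries (nerve r X)"
    using assms(2) by (auto simp: cycles_def)
  have "RC_boundary (z - c) = 0"
    using z(2) boundaries_subset_cycles by (auto simp: cycles_def)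
  then show ?thesis
    using z assms(2) by (intro bexI [of _ z]) (auto simp: cycles_def)
qed

section \<open>The comparison maps\<close>

lemma normalized_chains_nerve_mono:
  "r \<le> r' \<Longrightarrow> normalized_chains (nerve r X) n \<subseteq> normalized_chains (nerve r' X) n"
  using nerve_mono [of r r' X n] by (auto simp: normalized_chains_def subset_iff)

text \<open>
  The pages of the spectral sequence are the case \<open>s = 1\<close>, where the cycles are supported on arcs;
  reachability homology is the case \<open>s = r = \<infinity>\<close>.
\<close>

lemma fund_group_abelianization:
  assumes "conn_pointed_digraph X x0" "1 \<le> s" "s \<le> r"
    and rep: "\<And>c. c \<in> cycles (nerve r X) \<Longrightarrow>
      \<exists>z \<in> cycles (nerve s X). z - c \<in> boundaries (nerve r X)"
  shows "is_abelianization (fund_group r X x0)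
    ((RC X n)\<lparr>carrier := cycles (nerve s X)\<rparr> Mod (cycles (nerve s X) \<inter> boundaries (nerve r X)))
    (hurewicz_map (nerve r X) (cycles (nerve s X)))"
  unfolding fund_group_def RC_def
proof (rule edge_path_complex.hurewicz [OF edge_path_complex_nerve])
  show "[x0] \<in> nerve r X 0"
    using assms(1) by (simp add: nerve_vertex conn_pointed_digraph_def)
  show "cycles (nerve s X) \<subseteq> cycles (nerve r X)"
    using normalized_chains_nerve_mono [OF assms(3)] by (auto simp: cycles_def)
  show "\<exists>w. edge_path (nerve r X) x0 w x" if "[x] \<in> nerve r X 0" for x
    using nerve_connected [OF assms(1) order.trans [OF assms(2,3)] that] .
qed (use rep subgroup_cycles in auto)

text \<open>
  The numerators of the pages agree, and passing to the next page only enlarges the boundaries. A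
  chain on arcs homologous to a loop in \<open>N\<^sup>r(X)\<close> stays homologous to it in the next nerve, so each
  representative of the class on page \<open>r\<close> also represents the class on the next page.
\<close>

lemma hurewicz_map_projection:
  assumes wf: "pair_wf_digraph X" and r: "2 \<le> r" and g: "g \<in> carrier (fund_group (enat r) X x0)"
  shows "hurewicz_map (nerve (enat (Suc r)) X) (cycles (nerve 1 X)) (fund_group_incl (enat (Suc r)) X x0 g)
    = MPSS_proj X (int r) 1 0 (hurewicz_map (nerve (enat r) X) (cycles (nerve 1 X)) g)"
proof -
  let ?K = "nerve (enat r) X" and ?K' = "nerve (enat (Suc r)) X" and ?Z = "cycles (nerve 1 X)"
  interpret K: edge_path_complex ?K by (rule edge_path_complex_nerve)
  interpret K': edge_path_complex ?K' by (rule edge_path_complex_nerve)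
  obtain w where w: "g = K.loop_class x0 w" "edge_path ?K x0 w x0"
    using g by (auto simp: fund_group_def K.vertex_group_simps)
  have incl: "map id xs \<in> ?K' n" if "xs \<in> ?K n" for xs n
    using that nerve_mono [of "enat r" "enat (Suc r)" X n] by auto
  have w': "edge_path ?K' x0 w x0"
    using edge_path_map [OF incl w(2)] by (simp add: edge_step.map_id0)
  have incl_g: "fund_group_incl (enat (Suc r)) X x0 g = K'.loop_class x0 w"
    using K.vertex_group_map_class [OF K'.edge_path_complex_axioms incl w(2)] w(1)
    by (simp add: fund_group_incl_def edge_step.map_id0)
  have "boundaries ?K \<subseteq> boundaries ?K'"
    using normalized_chains_nerve_mono [of "enat r" "enat (Suc r)" X 2] by (auto simp: boundaries_def)
  then have coset: "(?Z \<inter> boundaries ?K') #>\<^bsub>RC X 1\<^esub> c = hurewicz_map ?K' ?Z (K'.loop_class x0 w)"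
    if "c \<in> hurewicz_map ?K ?Z g" for c
    using that K'.hurewicz_map_class_coset [OF w' subgroup_cycles, of c "nerve 1 X" "RC_gens X 1"]
    by (auto simp: w(1) K.hurewicz_map_class [OF w(2)] RC_def)
  have "path_chain w \<in> cycles ?K"
    using w(2) by (simp add: cycles_def K.path_chain_in_chains K.RC_boundary_path_chain)
  then have "hurewicz_map ?K ?Z g \<noteq> {}"
    using cycle_homologous_to_arc_cycle [OF wf, of "path_chain w" "enat r"]
    by (auto simp: w(1) K.hurewicz_map_class [OF w(2)])
  moreover have "hurewicz_map ?K ?Z g \<subseteq> ?Z"
    by (auto simp: hurewicz_map_def)
  moreover have "MPSS_B X (int r + 1) 1 0 = ?Z \<inter> boundaries ?K'"
    using MPSS_B_eq [of "Suc r" X] r by (simp add: add.commute)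
  ultimately show ?thesis
    using r coset by (auto simp: MPSS_proj_def MPSS_Z_eq incl_g Int_absorb2)
qed

text \<open>
  The chain of the image of a loop is the image of its chain, and boundaries go to boundaries.
\<close>

lemma hurewicz_map_natural:
  assumes f: "pointed_digraph_map X x0 Y y0 f" and g: "g \<in> carrier (fund_group \<infinity> X x0)"
  shows "hurewicz_map (nerve \<infinity> Y) (cycles (nerve \<infinity> Y)) (fund_group_map \<infinity> Y y0 f g)
    = RH_map Y 1 f (hurewicz_map (nerve \<infinity> X) (cycles (nerve \<infinity> X)) g)"
proof -
  let ?K = "nerve \<infinity> X" and ?K' = "nerve \<infinity> Y"
  interpret K: edge_path_complex ?K by (rule edge_path_complex_nerve)
  interpret K': edge_path_complex ?K' by (rule edge_path_complex_nerve)
  obtain w where w: "g = K.loop_class x0 w" "edge_path ?K x0 w x0"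
    using g by (auto simp: fund_group_def K.vertex_group_simps)
  define w' where "w' = map (map_edge_step f) w"
  have y0: "f x0 = y0" using f by (simp add: pointed_digraph_map_def)
  have w': "edge_path ?K' y0 w' y0"
    using edge_path_map [OF nerve_map [OF f] w(2)] by (simp add: y0 w'_def)
  have map_g: "fund_group_map \<infinity> Y y0 f g = K'.loop_class y0 w'"
    using K.vertex_group_map_class [OF K'.edge_path_complex_axioms nerve_map [OF f] w(2)] w(1)
    by (simp add: fund_group_map_def y0 w'_def)
  have coset: "RC_boundaries Y 1 #>\<^bsub>RC Y 1\<^esub> RC_map f c = hurewicz_map ?K' (cycles ?K') (K'.loop_class y0 w')"
    if "c \<in> hurewicz_map ?K (cycles ?K) g" for c
  proof -
    have "c - path_chain w \<in> boundaries ?K"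
      using that by (simp add: w(1) K.hurewicz_map_class [OF w(2)])
    then have "RC_map f (c - path_chain w) \<in> boundaries ?K'"
      using RC_map_boundaries [OF K.edge_path_complex_axioms K'.edge_path_complex_axioms]
        nerve_map [OF f] by blast
    then have b: "RC_map f c - path_chain w' \<in> boundaries ?K'"
      by (simp add: RC_map_path_chain w'_def)
    then have "RC_map f c - path_chain w' \<in> cycles ?K'"
      using K'.boundaries_subset_cycles by blast
    moreover have "path_chain w' \<in> cycles ?K'"
      using w' by (simp add: cycles_def K'.path_chain_in_chains K'.RC_boundary_path_chain)
    ultimately have "RC_map f c \<in> cycles ?K'"
      using normalized_chains_closed(2) [of "RC_map f c - path_chain w'" ?K' 1 "path_chain w'"]
      by (simp add: cycles_def)
    then show ?thesis
      using K'.hurewicz_map_class_coset [OF w' subgroup_cycles _ b] by (simp add: RC_boundaries_eq RC_def)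
  qed
  have "path_chain w \<in> hurewicz_map ?K (cycles ?K) g"
    using w(2) by (simp add: w(1) K.hurewicz_map_class cycles_def K.path_chain_in_chains K.RC_boundary_path_chain)
  then show ?thesis
    using coset by (auto simp: RH_map_def map_g)
qed

theorem theorem1p1:
  shows
    "(\<forall>(X :: 'a pair_pre_digraph) x0. conn_pointed_digraph X x0 \<longrightarrow>
       (\<exists>h :: nat \<Rightarrow> 'a edge_step list set \<Rightarrow> ('a list \<Rightarrow>\<^sub>0 int) set.
          (\<forall>r\<ge>2. is_abelianization (fund_group (enat r) X x0) (MPSS X (int r) 1 0) (h r)) \<and>
          (\<forall>r\<ge>2. \<forall>g \<in> carrier (fund_group (enat r) X x0).
             h (Suc r) (fund_group_incl (enat (Suc r)) X x0 g) = MPSS_proj X (int r) 1 0 (h r g))))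
     \<and>
     (\<exists>h :: 'a pair_pre_digraph \<Rightarrow> 'a \<Rightarrow> 'a edge_step list set \<Rightarrow> ('a list \<Rightarrow>\<^sub>0 int) set.
        (\<forall>X x0. conn_pointed_digraph X x0 \<longrightarrow>
           is_abelianization (fund_group \<infinity> X x0) (RH X 1) (h X x0)) \<and>
        (\<forall>X x0 Y y0 f. conn_pointed_digraph X x0 \<longrightarrow> conn_pointed_digraph Y y0 \<longrightarrow>
           pointed_digraph_map X x0 Y y0 f \<longrightarrow>
           (\<forall>g \<in> carrier (fund_group \<infinity> X x0).
              h Y y0 (fund_group_map \<infinity> Y y0 f g) = RH_map Y 1 f (h X x0 g))))"
proof (intro conjI allI impI)
  fix X :: "'a pair_pre_digraph" and x0
  assume X: "conn_pointed_digraph X x0"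
  then have wf: "pair_wf_digraph X"
    by (simp add: conn_pointed_digraph_def pair_loopfree_digraph_def)
  show "\<exists>h :: nat \<Rightarrow> 'a edge_step list set \<Rightarrow> ('a list \<Rightarrow>\<^sub>0 int) set.
          (\<forall>r\<ge>2. is_abelianization (fund_group (enat r) X x0) (MPSS X (int r) 1 0) (h r)) \<and>
          (\<forall>r\<ge>2. \<forall>g \<in> carrier (fund_group (enat r) X x0).
             h (Suc r) (fund_group_incl (enat (Suc r)) X x0 g) = MPSS_proj X (int r) 1 0 (h r g))"
  proof (intro exI [of _ "\<lambda>r. hurewicz_map (nerve (enat r) X) (cycles (nerve 1 X))"] conjI allI impI ballI)
    fix r :: nat assume "2 \<le> r"
    then show "is_abelianization (fund_group (enat r) X x0) (MPSS X (int r) 1 0)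
        (hurewicz_map (nerve (enat r) X) (cycles (nerve 1 X)))"
      unfolding MPSS_eq [OF \<open>2 \<le> r\<close>]
      by (intro fund_group_abelianization X cycle_homologous_to_arc_cycle wf)
        (auto simp: one_enat_def)
  qed (rule hurewicz_map_projection [OF wf])
next
  show "\<exists>h :: 'a pair_pre_digraph \<Rightarrow> 'a \<Rightarrow> 'a edge_step list set \<Rightarrow> ('a list \<Rightarrow>\<^sub>0 int) set.
        (\<forall>X x0. conn_pointed_digraph X x0 \<longrightarrow>
           is_abelianization (fund_group \<infinity> X x0) (RH X 1) (h X x0)) \<and>
        (\<forall>X x0 Y y0 f. conn_pointed_digraph X x0 \<longrightarrow> conn_pointed_digraph Y y0 \<longrightarrow>
           pointed_digraph_map X x0 Y y0 f \<longrightarrow>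
           (\<forall>g \<in> carrier (fund_group \<infinity> X x0).
              h Y y0 (fund_group_map \<infinity> Y y0 f g) = RH_map Y 1 f (h X x0 g)))"
  proof (intro exI [of _ "\<lambda>X x0. hurewicz_map (nerve \<infinity> X) (cycles (nerve \<infinity> X))"] conjI allI impI ballI)
    fix X :: "'a pair_pre_digraph" and x0
    assume "conn_pointed_digraph X x0"
    then show "is_abelianization (fund_group \<infinity> X x0) (RH X 1)
        (hurewicz_map (nerve \<infinity> X) (cycles (nerve \<infinity> X)))"
      unfolding RH_eq
    proof (rule fund_group_abelianization)
      show "\<exists>z \<in> cycles (nerve \<infinity> X). z - c \<in> boundaries (nerve \<infinity> X)"
        if "c \<in> cycles (nerve \<infinity> X)" for c
        using that by (intro bexI [of _ c]) simp_all
    qed auto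
  qed (rule hurewicz_map_natural)
qed

end
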